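(* Let $\alpha$ be a real number with $\alpha\ne 0,1$ and let $G$ be a connected graph with $n\ge 3$ vertices and $t$ spanning trees. Let $\Delta_1$ and $\delta$ be the maximum and minimum vertex degrees of $G$, and let $$t_1=\frac{2\,t(G\times K_2)}{t(G)},\qquad T=\frac12\left[\Delta_1+\delta+\sqrt{(\Delta_1-\delta)^2+4\Delta_1}\right].$$ Then for any real number $k\ge 0$: (i) if $G$ is bipartite, then $$s_\alpha(G)=\sigma_\alpha(G)>(n-2)(nt)^{\alpha/(n-1)}\left[\frac{(k+1)(nt)^{\alpha/[(k+1)(n-1)(n-2)]}}{T^{\alpha/[(k+1)(n-2)]}}-k\right]+T^\alpha;$$ (ii) if $G$ is non-bipartite, then $$s_\alpha(G)>(n-1)\,t_1^{\alpha/n}\left[\frac{(k+1)\,t_1^{\alpha/[(k+1)n(n-1)]}}{T^{\alpha/[(k+1)(n-1)]}}-k\right]+T^\alpha.$$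
   Context: Graphs are simple. For a graph $G$ with $n$ vertices, adjacency matrix $A(G)$ and diagonal matrix of vertex degrees $D(G)$, the Laplacian eigenvalues $\mu_1\ge\cdots\ge\mu_n=0$ are the eigenvalues of $L(G)=D(G)-A(G)$, and the signless Laplacian eigenvalues $q_1\ge\cdots\ge q_n$ are the eigenvalues of $Q(G)=D(G)+A(G)$. For a real number $\alpha$, $s_\alpha(G)=\sum_{i=1}^n q_i^\alpha$ is the sum of the $\alpha$-th powers of the signless Laplacian eigenvalues, and $\sigma_\alpha(G)=\sum_{i=1}^{n-1}\mu_i^\alpha$ is the sum of the $\alpha$-th powers of the non-zero Laplacian eigenvalues. $t(H)$ denotes the number of spanning trees of a graph $H$, and $t=t(G)$. $G\times K_2$ denotes the Cartesian product of $G$ and the complete graph $K_2$ on two vertices.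
   Formalization: In (i), for k=0 and G a star, only ≥ is claimed (equality holds, e.g. P_3). In (ii), G×K_2 is the direct (tensor) product, not the Cartesian one, for which (ii) fails (K_3, α=2, k=0). A zero eigenvalue contributes 0 to s_α even when α<0. *)

theory Defs
  imports "Jordan_Normal_Form.Char_Poly" Complex_Main
begin

type_synonym 'a ugraph = "'a set \<times> 'a set set"

abbreviation verts :: "'a ugraph \<Rightarrow> 'a set" where
  "verts G \<equiv> fst G"

abbreviation edges :: "'a ugraph \<Rightarrow> 'a set set" where
  "edges G \<equiv> snd G"

definition simple_graph :: "'a ugraph \<Rightarrow> bool" where
  "simple_graph G \<longleftrightarrow> finite (verts G) \<and>
     edges G \<subseteq> {{u, v} | u v. u \<in> verts G \<and> v \<in> verts G \<and> u \<noteq> v}"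

definition adj :: "'a ugraph \<Rightarrow> 'a \<Rightarrow> 'a \<Rightarrow> bool" where
  "adj G u v \<longleftrightarrow> {u, v} \<in> edges G"

definition vdegree :: "'a ugraph \<Rightarrow> 'a \<Rightarrow> nat" where
  "vdegree G v = card {u \<in> verts G. adj G v u}"

definition max_degree :: "'a ugraph \<Rightarrow> nat" where
  "max_degree G = Max (vdegree G ` verts G)"

definition min_degree :: "'a ugraph \<Rightarrow> nat" where
  "min_degree G = Min (vdegree G ` verts G)"

definition connected_graph :: "'a ugraph \<Rightarrow> bool" where
  "connected_graph G \<longleftrightarrow> verts G \<noteq> {} \<and>
     (\<forall>u \<in> verts G. \<forall>v \<in> verts G. (adj G)\<^sup>*\<^sup>* u v)"

definition bipartite_graph :: "'a ugraph \<Rightarrow> bool" where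
  "bipartite_graph G \<longleftrightarrow>
     (\<exists>A B. A \<union> B = verts G \<and> A \<inter> B = {} \<and>
        (\<forall>e \<in> edges G. \<exists>a \<in> A. \<exists>b \<in> B. e = {a, b}))"

definition star_graph :: "'a ugraph \<Rightarrow> bool" where
  "star_graph G \<longleftrightarrow> (\<exists>c \<in> verts G. edges G = {{c, v} | v. v \<in> verts G - {c}})"

definition is_cycle :: "'a ugraph \<Rightarrow> 'a list \<Rightarrow> bool" where
  "is_cycle G xs \<longleftrightarrow> 3 \<le> length xs \<and> distinct xs \<and>
     successively (adj G) xs \<and> adj G (last xs) (hd xs)"

definition tree_graph :: "'a ugraph \<Rightarrow> bool" where
  "tree_graph G \<longleftrightarrow> connected_graph G \<and> (\<nexists>xs. is_cycle G xs)"

definition num_spanning_trees :: "'a ugraph \<Rightarrow> nat" where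
  "num_spanning_trees G = card {F. F \<subseteq> edges G \<and> tree_graph (verts G, F)}"

(* The product G x H whose vertex set is the Cartesian product of the vertex sets and in
   which (u,x) ~ (v,y) iff u ~ v in G and x ~ y in H, i.e. the graph whose adjacency matrix
   is the Kronecker product of those of G and H (direct or tensor product). For this product
   2 t(G x K2) / t(G) is the product of the signless Laplacian eigenvalues of a connected G.
   For the product in which (u,x) ~ (v,y) iff one coordinate agrees and the other is
   adjacent, it would be the determinant of L(G) + 2 I instead. *)
definition graph_prod :: "'a ugraph \<Rightarrow> 'b ugraph \<Rightarrow> ('a \<times> 'b) ugraph" where
  "graph_prod G H =
     (verts G \<times> verts H, {{(u, x), (v, y)} | u v x y. adj G u v \<and> adj H x y})"

definition K2 :: "bool ugraph" where
  "K2 = (UNIV, {{False, True}})"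

(* An arbitrary enumeration of the vertices, used to index rows and columns; the eigenvalues
   do not depend on it. *)
definition vertex_list :: "'a ugraph \<Rightarrow> 'a list" where
  "vertex_list G = (SOME vs. distinct vs \<and> set vs = verts G)"

definition adjacency_mat :: "'a ugraph \<Rightarrow> real mat" where
  "adjacency_mat G = mat (card (verts G)) (card (verts G))
     (\<lambda>(i, j). if adj G (vertex_list G ! i) (vertex_list G ! j) then 1 else 0)"

definition degree_mat :: "'a ugraph \<Rightarrow> real mat" where
  "degree_mat G = mat (card (verts G)) (card (verts G))
     (\<lambda>(i, j). if i = j then real (vdegree G (vertex_list G ! i)) else 0)"

definition laplacian_mat :: "'a ugraph \<Rightarrow> real mat" where
  "laplacian_mat G = degree_mat G - adjacency_mat G"

definition signless_laplacian_mat :: "'a ugraph \<Rightarrow> real mat" where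
  "signless_laplacian_mat G = degree_mat G + adjacency_mat G"

(* Real eigenvalues with algebraic multiplicity, in non-increasing order; a symmetric n x n
   matrix has n of them. The list is indexed from 0. *)
definition eigenvalues_desc :: "real mat \<Rightarrow> real list" where
  "eigenvalues_desc M = rev (sorted_list_of_multiset (proots (char_poly M)))"

(* Since 0 powr alpha = 0 for every alpha, zero eigenvalues contribute nothing, also for
   alpha < 0. This matters for bipartite graphs, where the least eigenvalue is 0. *)
definition s_power_sum :: "real \<Rightarrow> 'a ugraph \<Rightarrow> real" where
  "s_power_sum \<alpha> G =
     (\<Sum>i < card (verts G). (eigenvalues_desc (signless_laplacian_mat G) ! i) powr \<alpha>)"

definition sigma_power_sum :: "real \<Rightarrow> 'a ugraph \<Rightarrow> real" where
  "sigma_power_sum \<alpha> G =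
     (\<Sum>i < card (verts G) - 1. (eigenvalues_desc (laplacian_mat G) ! i) powr \<alpha>)"

end

theory Submission
  imports Defs
begin

text \<open>
  Let \<open>x\<^sub>0 \<ge> x\<^sub>1 \<ge> \<dots>\<close> be the \<open>N\<close> non-zero signless Laplacian eigenvalues (\<open>N = n - 1\<close> if \<open>G\<close> is
  bipartite, \<open>N = n\<close> otherwise) and \<open>p\<close> their product. By the AM-GM inequality for \<open>x\<^sub>1, x\<^sub>2, \<dots>\<close> the
  power sum is at least \<open>f x\<^sub>0\<close> with \<open>f x = x\<^sup>\<alpha> + (N - 1) (p / x)\<^bsup>\<alpha> / (N - 1)\<^esup>\<close>, and \<open>f\<close> is strictly
  increasing to the right of the geometric mean of the eigenvalues. There the point \<open>T\<close> lies, since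
  \<open>T \<ge> \<Delta> + 1\<close> exceeds even the arithmetic mean. The vector that is \<open>T - \<delta>\<close> at a vertex of maximum
  degree, \<open>1\<close> at its neighbours and \<open>0\<close> elsewhere shows \<open>x\<^sub>0 \<ge> T\<close>, with equality only for stars.
  Finally \<open>f T\<close> is bounded from below by the inequality \<open>y + k \<ge> (k + 1) y\<^bsup>1 / (k + 1)\<^esup>\<close>.

  In the bipartite case \<open>p = n t\<close> is the matrix-tree theorem, proved by expanding the reduced Laplacian
  multilinearly along its rows into functional graphs. In the non-bipartite case \<open>p = t\<^sub>1\<close> follows from
  the matrix-tree theorems for \<open>G\<close> and for the double cover \<open>G \<times> K\<^sub>2\<close>, whose Laplacian spectrum is
  the union of the Laplacian and the signless Laplacian spectrum of \<open>G\<close>.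
\<close>

section \<open>Spanning trees as parent maps\<close>

lemma adj_sym: "adj G u v \<longleftrightarrow> adj G v u"
  by (simp add: adj_def insert_commute)

lemma simple_adjD:
  assumes "simple_graph G" "adj G u v"
  shows "u \<in> verts G" "v \<in> verts G" "u \<noteq> v"
proof -
  from assms obtain a b where "{u, v} = {a, b}" "a \<in> verts G" "b \<in> verts G" "a \<noteq> b"
    by (auto simp: simple_graph_def adj_def)
  then show "u \<in> verts G" "v \<in> verts G" "u \<noteq> v"
    by (auto simp: doubleton_eq_iff)
qed

lemma simple_graph_subset:
  assumes "simple_graph G" "F \<subseteq> edges G"
  shows "simple_graph (verts G, F)"
  using assms by (auto simp: simple_graph_def)

lemma rtranclp_adj_sym: "(adj G)\<^sup>*\<^sup>* u v \<Longrightarrow> (adj G)\<^sup>*\<^sup>* v u"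
  by (metis adj_sym sympI symp_rtranclp sympD)

text \<open>Spanning trees rooted at \<open>r\<close>, encoded by the map sending each vertex to its neighbour on the
  path to \<open>r\<close>; the map is the identity at \<open>r\<close> and outside the graph.\<close>

definition parent_maps :: "'a ugraph \<Rightarrow> 'a \<Rightarrow> ('a \<Rightarrow> 'a) set" where
  "parent_maps G r = {p. (\<forall>v. v \<notin> verts G - {r} \<longrightarrow> p v = v) \<and>
     (\<forall>v \<in> verts G - {r}. adj G v (p v)) \<and> (\<forall>v \<in> verts G. \<exists>k. (p ^^ k) v = r)}"

definition parent_edges :: "'a set \<Rightarrow> 'a \<Rightarrow> ('a \<Rightarrow> 'a) \<Rightarrow> 'a set set" where
  "parent_edges V r p = (\<lambda>v. {v, p v}) ` (V - {r})"

lemma parent_edgesD: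
  "{u, v} \<in> parent_edges V r p \<Longrightarrow>
     u \<in> V - {r} \<and> p u = v \<or> v \<in> V - {r} \<and> p v = u"
  by (auto simp: parent_edges_def doubleton_eq_iff)

lemma parent_reaches:
  assumes "p \<in> parent_maps G r" "v \<in> verts G"
  obtains k where "(p ^^ k) v = r"
  using assms unfolding parent_maps_def by blast

lemma parent_in_verts:
  assumes "simple_graph G" "p \<in> parent_maps G r" "v \<in> verts G"
  shows "p v \<in> verts G"
  using assms simple_adjD(2)[OF assms(1)] unfolding parent_maps_def by (cases "v = r") auto

lemma parent_edges_subset:
  assumes "p \<in> parent_maps G r"
  shows "parent_edges (verts G) r p \<subseteq> edges G"
  using assms by (auto simp: parent_maps_def parent_edges_def adj_def)

text \<open>Where \<open>p\<close> and \<open>q\<close> disagree at \<open>w\<close>, the edge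
  \<open>{w, p w}\<close> must be the \<open>q\<close>-edge of \<open>p w\<close>, so
  \<open>q (p w) = w\<close>. As \<open>p (p w) = w\<close> would trap the \<open>p\<close>-orbit in
  a 2-cycle avoiding \<open>r\<close>, the maps also disagree at \<open>p w\<close>. Disagreement
  thus persists along an orbit that never meets \<open>r\<close>, although every
  \<open>p\<close>-orbit does.\<close>

lemma parent_edges_inj:
  assumes G: "simple_graph G" and p: "p \<in> parent_maps G r" and q: "q \<in> parent_maps G r"
    and eq: "parent_edges (verts G) r p = parent_edges (verts G) r q"
  shows "p = q"
proof (rule ccontr)
  let ?V = "verts G"
  assume "p \<noteq> q"
  then obtain v where v: "p v \<noteq> q v" by auto
  then have vV: "v \<in> ?V - {r}" using p q unfolding parent_maps_def by (metis (mono_tags, lifting) mem_Collect_eq)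
  have step: "p w \<in> ?V - {r} \<and> p (p w) \<noteq> q (p w)" if w: "w \<in> ?V - {r}" "p w \<noteq> q w" for w
  proof -
    have "{w, p w} \<in> parent_edges ?V r q"
      using w eq by (auto simp: parent_edges_def)
    from parent_edgesD[OF this] w have pw: "p w \<in> ?V - {r}" "q (p w) = w" by auto
    have "p (p w) \<noteq> w"
    proof
      assume cyc: "p (p w) = w"
      have "(p ^^ k) w \<in> {w, p w}" for k
        by (induction k) (use cyc in auto)
      moreover obtain k where "(p ^^ k) w = r" using parent_reaches[OF p] w by blast
      ultimately show False using w pw by (metis DiffD2 insert_iff singletonD)
    qed
    with pw show ?thesis by simp
  qed
  have "(p ^^ k) v \<in> ?V - {r} \<and> p ((p ^^ k) v) \<noteq> q ((p ^^ k) v)" for k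
    by (induction k) (use v vV step in auto)
  moreover obtain k where "(p ^^ k) v = r" using parent_reaches[OF p] vV by blast
  ultimately show False by fastforce
qed

section \<open>Parent edges as spanning trees\<close>

lemma cycle_nth:
  assumes "is_cycle G xs" "i < length xs"
  shows "adj G (xs ! i) (xs ! (Suc i mod length xs))"
proof (cases "Suc i = length xs")
  case True
  then show ?thesis using assms
    by (metis Zero_not_Suc diff_Suc_1 hd_conv_nth is_cycle_def last_conv_nth list.size(3) mod_self)
next
  case False
  then show ?thesis using assms by (auto simp: is_cycle_def successively_conv_nth)
qed

lemma parent_edges_connected:
  assumes G: "simple_graph G" and r: "r \<in> verts G" and p: "p \<in> parent_maps G r"
  shows "connected_graph (verts G, parent_edges (verts G) r p)"
proof -
  let ?F = "(verts G, parent_edges (verts G) r p)"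
  have to_root: "v \<in> verts G \<Longrightarrow> (p ^^ k) v = r \<Longrightarrow> (adj ?F)\<^sup>*\<^sup>* v r" for k v
  proof (induction k arbitrary: v)
    case (Suc k)
    show ?case
    proof (cases "v = r")
      case False
      then have "adj ?F v (p v)" using Suc.prems by (auto simp: adj_def parent_edges_def)
      moreover have "(adj ?F)\<^sup>*\<^sup>* (p v) r"
        using Suc parent_in_verts[OF G p] by (simp add: funpow_swap1)
      ultimately show ?thesis by simp
    qed simp
  qed simp
  have "(adj ?F)\<^sup>*\<^sup>* v r" if "v \<in> verts G" for v
    using to_root[OF that] parent_reaches[OF p that] by blast
  then show ?thesis unfolding connected_graph_def
    using r rtranclp_adj_sym[of ?F] by (metis empty_iff fst_conv rtranclp_trans)
qed

text \<open>A vertex of a cycle with the most steps to the root would have its parent as both of its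
  cycle neighbours.\<close>

lemma parent_edges_acyclic:
  assumes G: "simple_graph G" and p: "p \<in> parent_maps G r"
  shows "\<not> is_cycle (verts G, parent_edges (verts G) r p) xs"
proof
  let ?V = "verts G" let ?F = "(?V, parent_edges ?V r p)"
  assume cyc: "is_cycle ?F xs"
  define m where "m = length xs"
  have m: "m \<ge> 3" and dist: "distinct xs" using cyc by (auto simp: is_cycle_def m_def)
  define d where "d v = (LEAST k. (p ^^ k) v = r)" for v
  have d_parent: "d v = Suc (d (p v))" if v: "v \<in> ?V - {r}" for v
  proof -
    obtain k where "(p ^^ k) v = r" using parent_reaches[OF p] v by blast
    moreover have "\<not> (p ^^ 0) v = r" using v by simp
    ultimately show ?thesis unfolding d_def
      by (subst Least_Suc) (auto simp: funpow_swap1)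
  qed
  have "finite (d ` set xs)" "d ` set xs \<noteq> {}" using m by (auto simp: m_def)
  from Max_in[OF this] obtain x where x: "x \<in> set xs" "d x = Max (d ` set xs)" by force
  then have xmax: "d y \<le> d x" if "y \<in> set xs" for y using that by simp
  obtain i where i: "i < m" "xs ! i = x" using x by (auto simp: in_set_conv_nth m_def)
  \<comment> \<open>An edge at \<open>x\<close> is the parent edge of one of its ends; if it were
    that of \<open>y\<close>, then \<open>d y = d x + 1\<close> would exceed the maximum.\<close>
  have up: "p x = y" if "adj ?F x y" "y \<in> set xs" for y
  proof (rule ccontr)
    assume "p x \<noteq> y"
    with that have "y \<in> ?V - {r}" "p y = x" using parent_edgesD by (fastforce simp: adj_def)+
    from d_parent[OF this(1)] this(2) xmax[OF that(2)] show False by simp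
  qed
  \<comment> \<open>\<open>s\<close> and \<open>q\<close> are the positions after and before
    \<open>i\<close> around the cycle; they differ because \<open>m \<ge> 3\<close>.\<close>
  define s where "s = Suc i mod m"
  define q where "q = (if i = 0 then m - 1 else i - 1)"
  have sq: "s < m" "q < m" "s \<noteq> q" "Suc q mod m = i"
    using i m by (auto simp: s_def q_def mod_Suc split: if_splits)
  have "adj ?F x (xs ! s)" using cycle_nth[OF cyc, of i] i by (simp add: s_def m_def)
  moreover have "adj ?F x (xs ! q)"
    using cycle_nth[OF cyc, of q] sq i by (simp add: m_def adj_sym[of _ "xs ! q"])
  ultimately have "xs ! s = xs ! q" using up sq by (metis m_def nth_mem)
  with dist sq show False by (simp add: m_def nth_eq_iff_index_eq)
qed

text \<open>Each vertex other than the root has a neighbour at smaller distance from the root;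
  choosing one gives a breadth-first spanning tree.\<close>

lemma parent_map_exists:
  assumes G: "simple_graph G" and conn: "connected_graph G" and r: "r \<in> verts G"
  shows "\<exists>p. p \<in> parent_maps G r"
proof -
  define d where "d v = (LEAST k. (adj G ^^ k) v r)" for v
  have "\<exists>w. adj G v w \<and> d w < d v" if v: "v \<in> verts G - {r}" for v
  proof -
    have "(adj G)\<^sup>*\<^sup>* v r" using conn r v by (auto simp: connected_graph_def)
    then obtain k where "(adj G ^^ k) v r" by (auto dest: rtranclp_imp_relpowp)
    then have dv: "(adj G ^^ d v) v r" unfolding d_def by (rule LeastI)
    then obtain k' where k': "d v = Suc k'" using v by (cases "d v") auto
    with dv obtain w where w: "adj G v w" "(adj G ^^ k') w r"
      by (metis relpowp_Suc_D2)
    then have "d w \<le> k'" unfolding d_def by (intro Least_le)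
    with w k' show ?thesis by auto
  qed
  then obtain c where c: "\<And>v. v \<in> verts G - {r} \<Longrightarrow> adj G v (c v) \<and> d (c v) < d v" by metis
  define p where "p v = (if v \<in> verts G - {r} then c v else v)" for v
  have "\<exists>k. (p ^^ k) v = r" if "v \<in> verts G" for v
    using that
  proof (induction "d v" arbitrary: v rule: less_induct)
    case less
    show ?case
    proof (cases "v = r")
      case True
      then show ?thesis by (intro exI[of _ 0]) simp
    next
      case False
      then have v: "v \<in> verts G - {r}" using less.prems by simp
      then obtain k where "(p ^^ k) (c v) = r"
        using less.hyps c simple_adjD(2)[OF G] by blast
      moreover have "p v = c v" using v by (simp add: p_def)
      ultimately show ?thesis by (intro exI[of _ "Suc k"]) (simp add: funpow_swap1)
    qed
  qed
  then have "p \<in> parent_maps G r" using c by (auto simp: parent_maps_def p_def)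
  then show ?thesis by blast
qed

text \<open>Loop erasure: if the new first vertex already lies on the path, the part before its
  occurrence is dropped.\<close>

lemma simple_path_exists:
  assumes "R\<^sup>*\<^sup>* u v"
  shows "\<exists>xs. xs \<noteq> [] \<and> hd xs = u \<and> last xs = v \<and> distinct xs \<and> successively R xs"
  using assms
proof (induction rule: converse_rtranclp_induct)
  case base
  show ?case by (intro exI[of _ "[v]"]) simp
next
  case (step u w)
  then obtain xs where xs: "xs \<noteq> []" "hd xs = w" "last xs = v" "distinct xs" "successively R xs"
    by blast
  show ?case
  proof (cases "u \<in> set xs")
    case True
    then obtain ys zs where "xs = ys @ u # zs" by (auto simp: in_set_conv_decomp)
    with xs show ?thesis by (intro exI[of _ "u # zs"]) (auto simp: successively_append_iff)
  next
    case False
    with xs step show ?thesis by (intro exI[of _ "u # xs"]) (auto simp: successively_Cons)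
  qed
qed

text \<open>The parent edges already connect all vertices, so an edge of \<open>F\<close> outside
  them would close a path of parent edges into a cycle of \<open>F\<close>.\<close>

lemma parent_edges_eq_tree:
  assumes G: "simple_graph (V, F)" and F: "tree_graph (V, F)" and r: "r \<in> V"
    and p: "p \<in> parent_maps (V, F) r"
  shows "parent_edges V r p = F"
proof (rule ccontr)
  let ?P = "(V, parent_edges V r p)"
  assume "parent_edges V r p \<noteq> F"
  moreover have sub: "parent_edges V r p \<subseteq> F" using parent_edges_subset[OF p] by simp
  ultimately obtain e where e: "e \<in> F" "e \<notin> parent_edges V r p" by auto
  then obtain u v where uv: "e = {u, v}" "u \<in> V" "v \<in> V" "u \<noteq> v"
    using G by (auto simp: simple_graph_def)
  have "(adj ?P)\<^sup>*\<^sup>* u v"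
    using parent_edges_connected[OF G _ p] r uv by (simp add: connected_graph_def)
  then obtain xs where xs: "xs \<noteq> []" "hd xs = u" "last xs = v" "distinct xs" "successively (adj ?P) xs"
    using simple_path_exists by metis
  \<comment> \<open>A path on one vertex would give \<open>u = v\<close>, and one on two vertices
    would make \<open>e\<close> itself a parent edge.\<close>
  have "length xs \<ge> 3"
  proof (rule ccontr)
    assume "\<not> length xs \<ge> 3"
    then consider a where "xs = [a]" | a b where "xs = [a, b]"
      using xs(1) by (cases xs; cases "tl xs"; cases "tl (tl xs)") auto
    then show False
      using xs uv e by cases (auto simp: adj_def)
  qed
  moreover have "successively (adj (V, F)) xs"
    by (rule successively_mono[OF xs(5)]) (use sub in \<open>auto simp: adj_def\<close>)
  moreover have "adj (V, F) (last xs) (hd xs)"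
    using xs uv e by (simp add: adj_def insert_commute)
  ultimately have "is_cycle (V, F) xs" using xs by (simp add: is_cycle_def)
  with F show False by (simp add: tree_graph_def)
qed

text \<open>For a fixed root every tree has exactly one orientation towards it. Counting trees thus
  becomes counting maps, the form in which the determinant expansion produces them.\<close>

lemma bij_betw_parent_maps_trees:
  assumes G: "simple_graph G" and r: "r \<in> verts G"
  shows "bij_betw (parent_edges (verts G) r) (parent_maps G r)
           {F. F \<subseteq> edges G \<and> tree_graph (verts G, F)}"
  unfolding bij_betw_def
proof (intro conjI equalityI subsetI)
  show "inj_on (parent_edges (verts G) r) (parent_maps G r)"
    using parent_edges_inj[OF G] by (intro inj_onI)
next
  fix F assume "F \<in> parent_edges (verts G) r ` parent_maps G r"
  then show "F \<in> {F. F \<subseteq> edges G \<and> tree_graph (verts G, F)}"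
    using parent_edges_subset[of _ G r] parent_edges_connected[OF G r] parent_edges_acyclic[OF G]
    unfolding tree_graph_def by blast
next
  fix F assume "F \<in> {F. F \<subseteq> edges G \<and> tree_graph (verts G, F)}"
  then have F: "F \<subseteq> edges G" "tree_graph (verts G, F)" by auto
  then obtain p where p: "p \<in> parent_maps (verts G, F) r"
    using parent_map_exists[OF simple_graph_subset[OF G F(1)], of r] r by (auto simp: tree_graph_def)
  then have "p \<in> parent_maps G r" using F(1) by (auto simp: parent_maps_def adj_def)
  with parent_edges_eq_tree[OF simple_graph_subset[OF G F(1)] F(2) r p]
  show "F \<in> parent_edges (verts G) r ` parent_maps G r" by auto
qed

corollary num_spanning_trees_eq_card_parent_maps:
  assumes "simple_graph G" "r \<in> verts G"
  shows "num_spanning_trees G = card (parent_maps G r)"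
  using bij_betw_same_card[OF bij_betw_parent_maps_trees[OF assms]]
  by (simp add: num_spanning_trees_def)

section \<open>The matrix-tree theorem\<close>

lemma finite_parent_maps:
  assumes "simple_graph G" "r \<in> verts G"
  shows "finite (parent_maps G r)"
proof -
  have "finite (edges G)"
    using assms(1) unfolding simple_graph_def
    by (auto intro!: finite_subset[of "edges G" "Pow (verts G)"])
  then show ?thesis
    using bij_betw_finite[OF bij_betw_parent_maps_trees[OF assms]] by simp
qed

lemma num_spanning_trees_pos:
  assumes G: "simple_graph G" and conn: "connected_graph G"
  shows "num_spanning_trees G > 0"
proof -
  obtain r where r: "r \<in> verts G" using conn by (auto simp: connected_graph_def)
  then have "parent_maps G r \<noteq> {}" using parent_map_exists[OF G conn] by blast
  then show ?thesis
    using finite_parent_maps[OF G r] num_spanning_trees_eq_card_parent_maps[OF G r]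
    by (simp add: card_gt_0_iff)
qed

text \<open>Conjugation by \<open>\<phi>\<close> turns parent maps of \<open>H\<close> injectively
  into parent maps of \<open>G\<close>. Applying this to an isomorphism and to its inverse gives
  equality.\<close>

lemma num_spanning_trees_le_iso:
  assumes G: "simple_graph G" and H: "simple_graph H" and ne: "verts H \<noteq> {}"
    and bij: "bij_betw \<phi> (verts H) (verts G)"
    and adj: "\<And>u v. u \<in> verts H \<Longrightarrow> v \<in> verts H \<Longrightarrow> adj H u v \<Longrightarrow> adj G (\<phi> u) (\<phi> v)"
  shows "num_spanning_trees H \<le> num_spanning_trees G"
proof -
  obtain r where r: "r \<in> verts H" using ne by auto
  have inj: "inj_on \<phi> (verts H)" and im: "\<phi> ` verts H = verts G"
    using bij by (auto simp: bij_betw_def)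
  define \<psi> where "\<psi> = the_inv_into (verts H) \<phi>"
  have \<psi>\<phi>: "\<psi> (\<phi> u) = u" if "u \<in> verts H" for u
    using the_inv_into_f_f[OF inj that] by (simp add: \<psi>_def)
  define \<Phi> where "\<Phi> p v = (if v \<in> verts G then \<phi> (p (\<psi> v)) else v)" for p v
  have \<Phi>: "\<Phi> p (\<phi> u) = \<phi> (p u)" if "u \<in> verts H" for p u
    using that im \<psi>\<phi> by (auto simp: \<Phi>_def)
  have "inj_on \<Phi> (parent_maps H r)"
  proof (intro inj_onI ext)
    fix p q u assume pq: "p \<in> parent_maps H r" "q \<in> parent_maps H r" "\<Phi> p = \<Phi> q"
    show "p u = q u"
    proof (cases "u \<in> verts H")
      case True
      then have "\<phi> (p u) = \<phi> (q u)" using \<Phi>[OF True] pq(3) by metis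
      then show ?thesis
        using inj parent_in_verts[OF H pq(1) True] parent_in_verts[OF H pq(2) True]
        by (auto dest: inj_onD)
    next
      case False
      then have "p u = u" "q u = u" using pq by (auto simp: parent_maps_def)
      then show ?thesis by simp
    qed
  qed
  moreover have "\<Phi> ` parent_maps H r \<subseteq> parent_maps G (\<phi> r)"
  proof
    fix f assume "f \<in> \<Phi> ` parent_maps H r"
    then obtain p where p: "p \<in> parent_maps H r" and f: "f = \<Phi> p" by auto
    have pow: "u \<in> verts H \<Longrightarrow> (f ^^ k) (\<phi> u) = \<phi> ((p ^^ k) u) \<and> (p ^^ k) u \<in> verts H" for k u
      by (induction k) (auto simp: f \<Phi> parent_in_verts[OF H p])
    have pr: "p r = r" using p by (auto simp: parent_maps_def)
    show "f \<in> parent_maps G (\<phi> r)"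
      unfolding parent_maps_def mem_Collect_eq
    proof (intro conjI allI impI ballI)
      fix v assume "v \<notin> verts G - {\<phi> r}"
      then show "f v = v" using \<Phi>[OF r, of p] pr by (cases "v = \<phi> r") (auto simp: f \<Phi>_def)
    next
      fix v assume "v \<in> verts G - {\<phi> r}"
      then obtain u where u: "u \<in> verts H - {r}" "v = \<phi> u" using im by auto
      then have "adj H u (p u)" using p by (auto simp: parent_maps_def)
      then show "adj G v (f v)"
        using u adj[of u "p u"] parent_in_verts[OF H p] by (auto simp: f \<Phi>)
    next
      fix v assume "v \<in> verts G"
      then obtain u where u: "u \<in> verts H" "v = \<phi> u" using im by auto
      obtain k where "(p ^^ k) u = r" using parent_reaches[OF p u(1)] .
      then show "\<exists>k. (f ^^ k) v = \<phi> r" using pow[OF u(1), of k] u by auto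
    qed
  qed
  ultimately have "card (parent_maps H r) \<le> card (parent_maps G (\<phi> r))"
    using finite_parent_maps[OF G, of "\<phi> r"] im r by (metis card_inj_on_le imageI)
  then show ?thesis
    using num_spanning_trees_eq_card_parent_maps[OF G, of "\<phi> r"]
      num_spanning_trees_eq_card_parent_maps[OF H r] im r by (metis imageI)
qed

lemma num_spanning_trees_iso:
  assumes G: "simple_graph G" and H: "simple_graph H" and ne: "verts H \<noteq> {}"
    and bij: "bij_betw \<phi> (verts H) (verts G)"
    and adj: "\<And>u v. u \<in> verts H \<Longrightarrow> v \<in> verts H \<Longrightarrow> adj H u v \<longleftrightarrow> adj G (\<phi> u) (\<phi> v)"
  shows "num_spanning_trees H = num_spanning_trees G"
proof (rule antisym)
  show "num_spanning_trees H \<le> num_spanning_trees G"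
    using num_spanning_trees_le_iso[OF G H ne bij] adj by blast
  have ne': "verts G \<noteq> {}" using bij ne by (auto simp: bij_betw_def)
  have "inv_into (verts H) \<phi> v \<in> verts H" "\<phi> (inv_into (verts H) \<phi> v) = v" if "v \<in> verts G" for v
    using that bij by (auto simp: bij_betw_def inv_into_into f_inv_into_f)
  then show "num_spanning_trees G \<le> num_spanning_trees H"
    using num_spanning_trees_le_iso[OF H G ne' bij_betw_inv_into[OF bij]] adj by metis
qed

text \<open>If every vertex reaches \<open>r\<close>, only the identity contributes to the Leibniz formula, since any
  other permutation would contain a cycle of \<open>f\<close>. Otherwise the indicator of the vertices that do
  not reach \<open>r\<close> is in the kernel.\<close>

lemma det_functional_graph:
  fixes f :: "nat \<Rightarrow> nat"
  assumes r: "r < n" and f: "\<And>i. i < n \<Longrightarrow> f i < n" "\<And>i. i < n \<Longrightarrow> i \<noteq> r \<Longrightarrow> f i \<noteq> i" "f r = r"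
  defines "A \<equiv> mat n n (\<lambda>(i, j). (if i = j then 1 else 0) - (if i \<noteq> r \<and> j = f i then 1 else 0) :: real)"
  shows "det A = (if \<forall>i<n. \<exists>k. (f ^^ k) i = r then 1 else 0)"
proof (cases "\<forall>i<n. \<exists>k. (f ^^ k) i = r")
  case True
  have A: "A \<in> carrier_mat n n" by (simp add: A_def)
  have zero: "(\<Prod>i = 0..<n. A $$ (i, p i)) = 0" if p: "p permutes {0..<n}" "p \<noteq> id" for p
  proof (rule ccontr)
    assume "(\<Prod>i = 0..<n. A $$ (i, p i)) \<noteq> 0"
    then have nz: "A $$ (i, p i) \<noteq> 0" if "i < n" for i using that by auto
    have step: "p i = i \<or> i \<noteq> r \<and> p i = f i" if "i < n" for i
    proof -
      have "p i < n" using p(1) that permutes_in_image[of p "{0..<n}" i] by simp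
      then show ?thesis using nz[OF that] that by (auto simp: A_def split: if_splits)
    qed
    obtain i where i: "p i \<noteq> i" using p(2) by (auto simp: fun_eq_iff)
    then have "i < n" using p(1) by (meson atLeastLessThan_iff permutes_not_in zero_le)
    \<comment> \<open>If \<open>p\<close> moves a point, it sends it to its \<open>f\<close>-image
      and, being injective, moves that image too. So the whole orbit is moved, including
      \<open>r\<close>, but row \<open>r\<close> only allows \<open>p r = r\<close>.\<close>
    have "(f ^^ k) i < n \<and> p ((f ^^ k) i) \<noteq> (f ^^ k) i" for k
    proof (induction k)
      case (Suc k)
      then have "f ((f ^^ k) i) = p ((f ^^ k) i)" using step by metis
      moreover have "f ((f ^^ k) i) < n" using Suc f(1) by simp
      moreover have "p (p ((f ^^ k) i)) \<noteq> p ((f ^^ k) i)"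
        using Suc permutes_inj[OF p(1)] by (auto dest: injD)
      ultimately show ?case by simp
    qed (use i \<open>i < n\<close> in auto)
    moreover obtain k where "(f ^^ k) i = r" using True \<open>i < n\<close> by auto
    ultimately have "p r \<noteq> r" by metis
    with step[OF r] show False by simp
  qed
  have "det A = (\<Sum>p\<in>{p. p permutes {0..<n}}. if p = id then 1 else 0)"
    unfolding det_def'[OF A]
  proof (intro sum.cong refl)
    fix p assume "p \<in> {p. p permutes {0..<n}}"
    then show "signof p * (\<Prod>i = 0..<n. A $$ (i, p i)) = (if p = id then 1 else 0)"
      using zero[of p] f(2) by (fastforce simp: A_def intro!: prod.neutral)
  qed
  also have "\<dots> = 1" by (simp add: finite_permutations permutes_id)
  finally show ?thesis using True by simp
next
  case False
  have A: "A \<in> carrier_mat n n" by (simp add: A_def)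
  define S where "S = {i. i < n \<and> (\<forall>k. (f ^^ k) i \<noteq> r)}"
  define w where "w = vec n (\<lambda>i. if i \<in> S then 1 else 0 :: real)"
  have "r \<notin> S" unfolding S_def by (auto intro!: exI[of _ 0])
  have S: "f i \<in> S \<longleftrightarrow> i \<in> S" if "i < n" "i \<noteq> r" for i
  proof -
    have "(\<exists>k. (f ^^ k) i = r) \<longleftrightarrow> (\<exists>k. (f ^^ k) (f i) = r)"
    proof
      assume "\<exists>k. (f ^^ k) i = r"
      then obtain k where "(f ^^ k) i = r" by auto
      then show "\<exists>k. (f ^^ k) (f i) = r" using that by (cases k) (auto simp: funpow_swap1)
    next
      assume "\<exists>k. (f ^^ k) (f i) = r"
      then obtain k where "(f ^^ Suc k) i = r" by (auto simp: funpow_swap1)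
      then show "\<exists>k. (f ^^ k) i = r" ..
    qed
    then show ?thesis using that f(1) by (auto simp: S_def)
  qed
  have "A *\<^sub>v w = 0\<^sub>v n"
  proof (rule eq_vecI)
    fix i assume "i < dim_vec (0\<^sub>v n :: real vec)"
    then have i: "i < n" by simp
    have "(A *\<^sub>v w) $ i = (\<Sum>j<n. ((if i = j then 1 else 0) - (if i \<noteq> r \<and> j = f i then 1 else 0)) * w $ j)"
      using i by (simp add: A_def w_def scalar_prod_def lessThan_atLeast0)
    also have "\<dots> = (\<Sum>j<n. if j = i then w $ j else 0) - (\<Sum>j<n. if j = f i then (if i \<noteq> r then w $ j else 0) else 0)"
      unfolding sum_subtractf[symmetric] by (intro sum.cong) auto
    also have "\<dots> = w $ i - (if i \<noteq> r then w $ f i else 0)" using i f(1) by simp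
    also have "\<dots> = 0" using i f(1) S[of i] \<open>r \<notin> S\<close> by (auto simp: w_def)
    finally show "(A *\<^sub>v w) $ i = 0\<^sub>v n $ i" using i by simp
  qed (simp add: A_def)
  moreover obtain i where "i < n" "i \<in> S" using False by (auto simp: S_def)
  then have "w \<noteq> 0\<^sub>v n" by (auto simp: w_def dest!: arg_cong[where f = "\<lambda>v. v $ i"])
  moreover have "w \<in> carrier_vec n" by (simp add: w_def)
  ultimately have "det A = 0" using det_0_iff_vec_prod_zero[OF A] by blast
  then show ?thesis using False by auto
qed

lemma det_eq_0_if_zero_row:
  fixes A :: "real mat"
  assumes A: "A \<in> carrier_mat n n" and i: "i < n" and z: "\<And>j. j < n \<Longrightarrow> A $$ (i, j) = 0"
  shows "det A = 0"
  unfolding det_def'[OF A]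
proof (intro sum.neutral ballI)
  fix p assume "p \<in> {p. p permutes {0..<n}}"
  then have "p i < n" using i permutes_in_image[of p "{0..<n}" i] by simp
  then have "(\<Prod>i = 0..<n. A $$ (i, p i)) = 0" using i z by (intro prod_zero bexI[of _ i]) auto
  then show "signof p * (\<Prod>i = 0..<n. A $$ (i, p i)) = 0" by simp
qed

text \<open>A unit vector in row \<open>r\<close>, instead of deleting row and column
  \<open>r\<close>, keeps the index set intact. Row \<open>i \<noteq> r\<close> is the sum of
  \<open>e_i - e_u\<close> over the neighbours \<open>u\<close> of \<open>i\<close>, so
  multilinearity turns the determinant into a sum over maps \<open>f\<close> picking a neighbour of
  every such vertex; a term is 1 if \<open>f\<close> is a parent map and 0 otherwise.\<close>

lemma matrix_tree_nat:
  fixes H :: "nat ugraph"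
  assumes H: "simple_graph H" and V: "verts H = {..<n}" and r: "r < n"
  shows "det (mat n n (\<lambda>(i, j). if i = r then if j = r then 1 else 0 else
      (if i = j then real (vdegree H i) else 0) - (if adj H i j then 1 else 0))) =
    real (num_spanning_trees H)"
proof -
  note ad = simple_adjD[OF H, unfolded V]
  define a :: "nat \<Rightarrow> nat \<Rightarrow> real vec" where
    "a i u = (if i = r then if u = r then unit_vec n r else 0\<^sub>v n else
       if adj H i u then unit_vec n i - unit_vec n u else 0\<^sub>v n)" for i u
  have a: "a \<in> {0..<n} \<rightarrow> {0..<n} \<rightarrow> carrier_vec n" by (auto simp: a_def)
  \<comment> \<open>Being the identity outside \<open>{0..<n}\<close> makes these maps finite in
    number and agrees with the convention of \<open>parent_maps\<close>.\<close>
  define \<F> where "\<F> = {f. (\<forall>i\<in>{0..<n}. f i \<in> {0..<n}) \<and> (\<forall>i. i \<notin> {0..<n} \<longrightarrow> f i = i)}"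
  have "(mat n n (\<lambda>(i, j). if i = r then if j = r then 1 else 0 else
      (if i = j then real (vdegree H i) else 0) - (if adj H i j then 1 else 0))) =
     mat\<^sub>r n n (\<lambda>i. finsum_vec TYPE(real) n (a i) {0..<n})" (is "?L = ?R")
  proof (rule eq_matI)
    fix i j assume "i < dim_row ?R" "j < dim_col ?R"
    then have ij: "i < n" "j < n" by auto
    have "?R $$ (i, j) = (\<Sum>u\<in>{0..<n}. a i u $ j)"
      using ij a by (auto simp: mat_of_rows_def intro!: index_finsum_vec)
    also have "\<dots> = ?L $$ (i, j)"
    proof (cases "i = r")
      case True
      have "(\<Sum>u\<in>{0..<n}. a i u $ j) = (\<Sum>u\<in>{0..<n}. if u = r then (if j = r then 1 else 0) else 0)"
        using True ij by (intro sum.cong) (auto simp: a_def)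
      then show ?thesis using True ij r by simp
    next
      case False
      have "(\<Sum>u\<in>{0..<n}. a i u $ j) =
        (\<Sum>u\<in>{0..<n}. (if adj H i u then (if i = j then 1 else 0) else 0) -
           (if u = j then (if adj H i j then 1 else 0) else 0))"
        using False ij by (intro sum.cong) (auto simp: a_def)
      also have "\<dots> = (if i = j then real (card {u \<in> {0..<n}. adj H i u}) else 0) - (if adj H i j then 1 else 0)"
        using ij by (simp add: sum_subtractf sum.inter_filter[symmetric])
      finally show ?thesis using False ij by (simp add: vdegree_def V lessThan_atLeast0)
    qed
    finally show "?L $$ (i, j) = ?R $$ (i, j)" by simp
  qed auto
  then have "det ?L = (\<Sum>f\<in>\<F>. det (mat\<^sub>r n n (\<lambda>i. a i (f i))))"
    unfolding \<F>_def using det_linear_rows_sum[OF _ a] by simp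
  also have "\<dots> = (\<Sum>f\<in>\<F>. if f \<in> parent_maps H r then 1 else 0)"
  proof (intro sum.cong refl)
    fix f assume f: "f \<in> \<F>"
    then have fn: "\<And>i. i < n \<Longrightarrow> f i < n" "\<And>i. \<not> i < n \<Longrightarrow> f i = i" by (auto simp: \<F>_def)
    let ?A = "mat\<^sub>r n n (\<lambda>i. a i (f i))"
    show "det ?A = (if f \<in> parent_maps H r then 1 else 0)"
    proof (cases "f r = r \<and> (\<forall>i<n. i \<noteq> r \<longrightarrow> adj H i (f i))")
      case True
      have "?A = mat n n (\<lambda>(i, j). (if i = j then 1 else 0) - (if i \<noteq> r \<and> j = f i then 1 else 0))"
        using True r by (intro eq_matI) (auto simp: a_def mat_of_rows_def fn(1))
      moreover have "f i \<noteq> i" if "i < n" "i \<noteq> r" for i using True that ad(3) by metis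
      ultimately have "det ?A = (if \<forall>i<n. \<exists>k. (f ^^ k) i = r then 1 else 0)"
        using det_functional_graph[OF r fn(1)] True by simp
      moreover have "f \<in> parent_maps H r \<longleftrightarrow> (\<forall>i<n. \<exists>k. (f ^^ k) i = r)"
        using True fn(2) by (auto simp: parent_maps_def V)
      ultimately show ?thesis by simp
    next
      case False
      then obtain i where i: "i < n" "a i (f i) = 0\<^sub>v n" using r by (auto simp: a_def)
      have "det ?A = 0" by (rule det_eq_0_if_zero_row[OF _ i(1)]) (use i in auto)
      moreover have "f \<notin> parent_maps H r" using False by (auto simp: parent_maps_def V)
      ultimately show ?thesis by simp
    qed
  qed
  also have "\<dots> = real (card (parent_maps H r))"
  proof -
    have "parent_maps H r \<subseteq> \<F>"
      using parent_in_verts[OF H] by (auto simp: \<F>_def V parent_maps_def)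
    moreover have "finite \<F>" unfolding \<F>_def by (rule finite_bounded_functions) auto
    ultimately show ?thesis by (simp add: sum.If_cases Int_absorb1)
  qed
  finally show ?thesis using num_spanning_trees_eq_card_parent_maps[OF H, of r] V r by simp
qed

text \<open>The enumeration \<open>vs\<close> is a parameter so that the vertices of the double
  cover can be listed as two consecutive copies of those of \<open>G\<close>.\<close>

definition vmat :: "'a list \<Rightarrow> ('a \<Rightarrow> 'a \<Rightarrow> real) \<Rightarrow> real mat" where
  "vmat vs h = mat (length vs) (length vs) (\<lambda>(i, j). h (vs ! i) (vs ! j))"

definition lap :: "'a ugraph \<Rightarrow> 'a \<Rightarrow> 'a \<Rightarrow> real" where
  "lap G u v = (if u = v then real (vdegree G u) else 0) - (if adj G u v then 1 else 0)"

lemma vmat_carrier [simp]: "vmat vs h \<in> carrier_mat (length vs) (length vs)"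
  by (simp add: vmat_def)

text \<open>The graph is copied onto the positions in \<open>vs\<close>, where
  \<open>matrix_tree_nat\<close> applies; expanding along the unit row \<open>r\<close> then leaves
  only the minor.\<close>

theorem matrix_tree:
  assumes G: "simple_graph G" and vs: "distinct vs" "set vs = verts G" and r: "r < length vs"
  shows "det (mat_delete (vmat vs (lap G)) r r) = real (num_spanning_trees G)"
proof -
  define n where "n = length vs"
  define H :: "nat ugraph" where
    "H = ({..<n}, {{i, j} | i j. i < n \<and> j < n \<and> adj G (vs ! i) (vs ! j)})"
  have VH: "verts H = {..<n}" by (simp add: H_def)
  have adjH: "adj H i j \<longleftrightarrow> i < n \<and> j < n \<and> adj G (vs ! i) (vs ! j)" for i j
    by (auto simp: H_def adj_def doubleton_eq_iff insert_commute)
  have H: "simple_graph H" unfolding simple_graph_def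
    using simple_adjD(3)[OF G] by (fastforce simp: H_def)
  have bij: "bij_betw ((!) vs) {..<n} (verts G)" using bij_betw_nth[OF vs(1), of "{..<n}"] vs n_def by auto
  have t: "num_spanning_trees H = num_spanning_trees G"
    using num_spanning_trees_iso[OF G H _ bij[folded VH]] r by (auto simp: VH adjH n_def)
  have deg: "vdegree H i = vdegree G (vs ! i)" if "i < n" for i
  proof -
    have "bij_betw ((!) vs) {j \<in> {..<n}. adj H i j} {v \<in> verts G. adj G (vs ! i) v}"
      using bij that unfolding bij_betw_def by (auto simp: adjH inj_on_def)
    then show ?thesis by (auto simp: vdegree_def VH dest: bij_betw_same_card)
  qed
  define M where "M = mat n n (\<lambda>(i, j). if i = r then if j = r then 1 else 0 else
      (if i = j then real (vdegree H i) else 0) - (if adj H i j then 1 else 0))"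
  have M: "M \<in> carrier_mat n n" by (simp add: M_def)
  have rn: "r < n" using r n_def by simp
  have "det M = (\<Sum>j<n. M $$ (r, j) * cofactor M r j)"
    by (rule laplace_expansion_row[OF M rn])
  also have "\<dots> = (\<Sum>j<n. if j = r then cofactor M r r else 0)"
    using rn by (intro sum.cong) (auto simp: M_def)
  also have "\<dots> = det (mat_delete M r r)" using rn by (simp add: cofactor_def)
  also have "mat_delete M r r = mat_delete (vmat vs (lap G)) r r"
    using vs(1) by (intro eq_matI)
      (auto simp: mat_delete_def M_def vmat_def lap_def n_def[symmetric] adjH deg nth_eq_iff_index_eq)
  finally show ?thesis using matrix_tree_nat[OF H VH rn] t by (simp add: M_def)
qed

lemma coeff_char_poly_0:
  fixes A :: "real mat"
  assumes "A \<in> carrier_mat n n"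
  shows "coeff (char_poly A) 0 = (-1) ^ n * det A"
proof -
  have "coeff (char_poly A) 0 = poly (char_poly A) 0" by (simp add: poly_0_coeff_0)
  also have "\<dots> = det (- char_matrix A 0)" by (rule char_poly_matrix[OF assms])
  also have "- char_matrix A 0 = (-1) \<cdot>\<^sub>m A"
    using assms by (intro eq_matI) (auto simp: char_matrix_def)
  finally show ?thesis using assms by simp
qed

text \<open>The derivative of the characteristic polynomial is the sum of the characteristic
  polynomials of the principal submatrices with one index deleted, and by \<open>matrix_tree\<close>
  each of these has the number of spanning trees as its determinant.\<close>

corollary coeff_char_poly_lap_1:
  assumes G: "simple_graph G" and vs: "distinct vs" "set vs = verts G"
  shows "coeff (char_poly (vmat vs (lap G))) 1 =
    (-1) ^ (length vs - 1) * (real (length vs) * real (num_spanning_trees G))"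
proof -
  let ?L = "vmat vs (lap G)" let ?n = "length vs"
  have "coeff (char_poly ?L) 1 = coeff (pderiv (char_poly ?L)) 0"
    by (simp add: coeff_pderiv)
  also have "\<dots> = (\<Sum>i<?n. coeff (char_poly (mat_delete ?L i i)) 0)"
    by (simp add: pderiv_char_poly[OF vmat_carrier] coeff_sum)
  also have "\<dots> = (\<Sum>i<?n. (-1) ^ (?n - 1) * real (num_spanning_trees G))"
  proof (intro sum.cong refl)
    fix i assume i: "i \<in> {..<?n}"
    have "mat_delete ?L i i \<in> carrier_mat (?n - 1) (?n - 1)"
      by (rule mat_delete_carrier[OF vmat_carrier])
    from coeff_char_poly_0[OF this] matrix_tree[OF G vs, of i] i
    show "coeff (char_poly (mat_delete ?L i i)) 0 = (-1) ^ (?n - 1) * real (num_spanning_trees G)"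
      by simp
  qed
  finally show ?thesis by simp
qed

section \<open>The spectral theorem for real symmetric matrices\<close>

text \<open>Over the complex numbers an eigenvector \<open>v\<close> exists, and by symmetry its
  Hermitian form \<open>S\<close> is real. Since \<open>S = a * N\<close> with
  \<open>N = |v|^2 > 0\<close>, the eigenvalue \<open>a\<close> is real, hence a root of the real
  characteristic polynomial.\<close>

lemma symmetric_real_has_eigenvalue:
  fixes M :: "real mat"
  assumes M: "M \<in> carrier_mat n n" "transpose_mat M = M" and n: "n > 0"
  shows "\<exists>e v. eigenvector M v e"
proof -
  have sym: "M $$ (i, j) = M $$ (j, i)" if "i < n" "j < n" for i j
    using that M by (metis carrier_matD index_transpose_mat(1))
  let ?A = "map_mat complex_of_real M"
  have A: "?A \<in> carrier_mat n n" using M by simp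
  obtain as where as: "char_poly ?A = (\<Prod>a\<leftarrow>as. [:- a, 1:])" "length as = n"
    using char_poly_factorized[OF A] by blast
  then obtain a as' where "as = a # as'" using n by (cases as) auto
  then have "poly (char_poly ?A) a = 0" using as by simp
  then have ev: "eigenvalue ?A a" using eigenvalue_root_char_poly[OF A] by simp
  then obtain v where "eigenvector ?A v a" by (auto simp: eigenvalue_def)
  then have v: "v \<in> carrier_vec n" "v \<noteq> 0\<^sub>v n" and Av: "?A *\<^sub>v v = a \<cdot>\<^sub>v v"
    using A by (auto simp: eigenvector_def)
  have row: "(\<Sum>j<n. complex_of_real (M $$ (i, j)) * v $ j) = a * v $ i" if "i < n" for i
  proof -
    have "(?A *\<^sub>v v) $ i = (\<Sum>j<n. complex_of_real (M $$ (i, j)) * v $ j)"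
      using that M v by (auto simp: scalar_prod_def lessThan_atLeast0)
    then show ?thesis using Av that v by simp
  qed
  define S where "S = (\<Sum>i<n. \<Sum>j<n. complex_of_real (M $$ (i, j)) * v $ j * cnj (v $ i))"
  define N where "N = (\<Sum>i<n. (cmod (v $ i))\<^sup>2)"
  have "S = (\<Sum>i<n. (\<Sum>j<n. complex_of_real (M $$ (i, j)) * v $ j) * cnj (v $ i))"
    by (simp add: S_def sum_distrib_right)
  also have "\<dots> = (\<Sum>i<n. a * (v $ i * cnj (v $ i)))"
    by (intro sum.cong) (simp_all add: row mult.assoc)
  also have "\<dots> = a * of_real N"
    by (simp add: N_def complex_norm_square sum_distrib_left del: of_real_power)
  finally have SN: "S = a * of_real N" .
  have "cnj S = (\<Sum>i<n. \<Sum>j<n. complex_of_real (M $$ (i, j)) * v $ i * cnj (v $ j))"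
    by (simp add: S_def mult_ac)
  also have "\<dots> = (\<Sum>j<n. \<Sum>i<n. complex_of_real (M $$ (i, j)) * v $ i * cnj (v $ j))"
    by (rule sum.swap)
  also have "\<dots> = S" unfolding S_def using sym by (intro sum.cong) auto
  finally have "cnj S = S" .
  obtain i where "i < n" "v $ i \<noteq> 0" using v by (metis carrier_vecD eq_vecI index_zero_vec)
  then have "N > 0" unfolding N_def by (intro sum_pos2[where i = i]) auto
  then have "cnj a = a" using \<open>cnj S = S\<close> by (simp add: SN)
  then have a: "a = complex_of_real (Re a)" by (metis Reals_cnj_iff of_real_Re)
  interpret h: field_hom complex_of_real by unfold_locales auto
  have "poly (char_poly ?A) (complex_of_real (Re a)) = 0"
    using \<open>poly (char_poly ?A) a = 0\<close> a by simp
  then have "poly (char_poly M) (Re a) = 0"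
    unfolding of_real_hom.char_poly_hom[OF M(1)] of_real_hom.poly_map_poly by simp
  then show ?thesis using eigenvalue_root_char_poly[OF M(1)] by (auto simp: eigenvalue_def)
qed

text \<open>The Householder reflection exchanging \<open>v\<close> with the first unit vector; for
  \<open>v = e\<^sub>0\<close> the division by zero makes it the identity.\<close>

definition householder :: "nat \<Rightarrow> real vec \<Rightarrow> real mat" where
  "householder n v = mat n n (\<lambda>(i, j). (if i = j then 1 else 0) -
     (v $ i - (if i = 0 then 1 else 0)) * (v $ j - (if j = 0 then 1 else 0)) / (1 - v $ 0))"

lemma householder_carrier [simp]: "householder n v \<in> carrier_mat n n"
  by (simp add: householder_def)

lemma householder_transpose [simp]: "transpose_mat (householder n v) = householder n v"
  by (rule eq_matI) (auto simp: householder_def)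

lemma householder_col_0:
  assumes v: "v \<in> carrier_vec n" "v \<bullet> v = 1" and "n > 0"
  shows "col (householder n v) 0 = v"
proof -
  have sum: "(\<Sum>i<n. (v $ i)\<^sup>2) = 1"
    using v by (simp add: scalar_prod_def power2_eq_square lessThan_atLeast0)
  show ?thesis
  proof (rule eq_vecI)
    fix i assume i: "i < dim_vec v"
    show "col (householder n v) 0 $ i = v $ i"
    \<comment> \<open>A unit vector whose first entry is 1 is the first unit vector; this is the
      degenerate case in which division by \<open>1 - v $ 0\<close> yields 0.\<close>
    proof (cases "v $ 0 = 1")
      case True
      have "(\<Sum>i\<in>{..<n} - {0}. (v $ i)\<^sup>2) = 0"
        using sum True assms(3) by (simp add: sum.remove[of _ 0])
      then have "i \<noteq> 0 \<Longrightarrow> v $ i = 0" using i v by (auto simp: sum_nonneg_eq_0_iff)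
      with True i v show ?thesis by (auto simp: householder_def)
    next
      case False
      then show ?thesis using i v assms(3) by (auto simp: householder_def field_simps)
    qed
  qed (use v in \<open>auto simp: householder_def\<close>)
qed

lemma householder_squared:
  assumes v: "v \<in> carrier_vec n" "v \<bullet> v = 1" and n: "n > 0"
  shows "householder n v * householder n v = 1\<^sub>m n"
proof (rule eq_matI)
  have sum: "(\<Sum>i<n. v $ i * v $ i) = 1"
    using v by (simp add: scalar_prod_def lessThan_atLeast0)
  define \<delta> :: "nat \<Rightarrow> nat \<Rightarrow> real" where "\<delta> i j = (if i = j then 1 else 0)" for i j
  \<comment> \<open>With \<open>w = v - e_0\<close> the reflection is \<open>I - c w w^T\<close>; it
    squares to \<open>I\<close> because \<open>c^2 |w|^2 = 2 c\<close>.\<close>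
  define w where "w i = v $ i - \<delta> i 0" for i
  define c where "c = 1 / (1 - v $ 0)"
  have H: "householder n v $$ (i, j) = \<delta> i j - c * w i * w j" if "i < n" "j < n" for i j
    using that by (simp add: householder_def c_def w_def \<delta>_def)
  have ww: "(\<Sum>i<n. w i * w i) = 2 - 2 * v $ 0"
  proof -
    have "(\<Sum>i<n. w i * w i) = (\<Sum>i<n. v $ i * v $ i - 2 * (if i = 0 then v $ i else 0) + (if i = 0 then 1 else 0))"
      by (intro sum.cong) (auto simp: w_def \<delta>_def algebra_simps)
    also have "\<dots> = 2 - 2 * v $ 0"
      using sum n by (simp add: sum.distrib sum_subtractf flip: sum_distrib_left)
    finally show ?thesis .
  qed
  \<comment> \<open>Unlike \<open>c |w|^2 = 2\<close>, this form stays true for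
    \<open>v $ 0 = 1\<close>, where \<open>c = 0\<close>.\<close>
  have cc: "c * c * (\<Sum>i<n. w i * w i) = 2 * c"
  proof -
    have "2 - 2 * v $ 0 = 2 * (1 - v $ 0)" by simp
    moreover have "1 / d * (1 / d) * (2 * d) = 2 * (1 / d)" for d :: real by simp
    ultimately show ?thesis unfolding ww c_def by (simp only:)
  qed
  fix i j assume "i < dim_row (1\<^sub>m n :: real mat)" "j < dim_col (1\<^sub>m n :: real mat)"
  then have ij: "i < n" "j < n" by auto
  have "(householder n v * householder n v) $$ (i, j) =
      (\<Sum>k<n. householder n v $$ (i, k) * householder n v $$ (k, j))"
    using ij by (auto simp: scalar_prod_def lessThan_atLeast0 householder_def)
  also have "\<dots> = (\<Sum>k<n. (\<delta> i k - c * w i * w k) * (\<delta> k j - c * w k * w j))"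
    using ij by (intro sum.cong) (simp_all add: H)
  also have "\<dots> = (\<Sum>k<n. (if k = i then \<delta> i j - c * w i * w j else 0)
      - (if k = j then c * w i * w j else 0) + c * c * w i * w j * (w k * w k))"
    by (intro sum.cong refl) (simp add: \<delta>_def algebra_simps)
  also have "\<dots> = \<delta> i j - 2 * (c * w i * w j) + w i * w j * (c * c * (\<Sum>k<n. w k * w k))"
    using ij by (simp add: sum.distrib sum_subtractf sum_distrib_left mult_ac)
  also have "\<dots> = \<delta> i j" unfolding cc by (simp add: algebra_simps)
  finally show "(householder n v * householder n v) $$ (i, j) = 1\<^sub>m n $$ (i, j)"
    using ij by (simp add: \<delta>_def)
qed (auto simp: householder_def)

section \<open>Orthogonal diagonalisation\<close>

definition orth_diag :: "real mat \<Rightarrow> nat \<Rightarrow> real mat \<Rightarrow> (nat \<Rightarrow> real) \<Rightarrow> bool" where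
  "orth_diag M n P e \<longleftrightarrow> P \<in> carrier_mat n n \<and> transpose_mat P * P = 1\<^sub>m n \<and>
     P * transpose_mat P = 1\<^sub>m n \<and> M = P * mat_diag n e * transpose_mat P"

lemma orth_diag_conj:
  assumes H: "H \<in> carrier_mat n n" "transpose_mat H * H = 1\<^sub>m n" "H * transpose_mat H = 1\<^sub>m n"
    and B: "orth_diag B n P e"
  shows "orth_diag (H * B * transpose_mat H) n (H * P) e"
proof -
  note P = B[unfolded orth_diag_def]
  let ?t = transpose_mat
  have c: "P \<in> carrier_mat n n" "?t P \<in> carrier_mat n n" "?t H \<in> carrier_mat n n"
    "mat_diag n e \<in> carrier_mat n n"
    using P H by auto
  note as = assoc_mult_mat[of _ n n _ n _ n] mult_carrier_mat[of _ n n _ n]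
  have t: "?t (H * P) = ?t P * ?t H" using transpose_mult[OF H(1) c(1)] .
  have "?t (H * P) * (H * P) = ?t P * (?t H * H) * P"
    unfolding t using c H(1) by (simp add: as)
  then have 1: "?t (H * P) * (H * P) = 1\<^sub>m n" using P H c by simp
  have "(H * P) * ?t (H * P) = H * (P * ?t P) * ?t H"
    unfolding t using c H(1) by (simp add: as)
  then have 2: "(H * P) * ?t (H * P) = 1\<^sub>m n" using P H c by simp
  have "H * B * ?t H = H * P * mat_diag n e * ?t (H * P)"
    unfolding t using c H(1) P by (simp add: as)
  with 1 2 show ?thesis using mult_carrier_mat[OF H(1) c(1)] unfolding orth_diag_def by blast
qed

lemma orth_diag_four_block:
  assumes "orth_diag B n P e"
  shows "orth_diag (four_block_mat (mat 1 1 (\<lambda>_. c)) (0\<^sub>m 1 n) (0\<^sub>m n 1) B) (Suc n)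
    (four_block_mat (1\<^sub>m 1) (0\<^sub>m 1 n) (0\<^sub>m n 1) P) (\<lambda>i. case i of 0 \<Rightarrow> c | Suc j \<Rightarrow> e j)"
proof -
  note P = assms[unfolded orth_diag_def]
  let ?t = transpose_mat
  let ?P = "four_block_mat (1\<^sub>m 1) (0\<^sub>m 1 n) (0\<^sub>m n 1) P"
  let ?D = "mat_diag (Suc n) (\<lambda>i. case i of 0 \<Rightarrow> c | Suc j \<Rightarrow> e j)"
  have c: "P \<in> carrier_mat n n" "?t P \<in> carrier_mat n n" "mat_diag n e \<in> carrier_mat n n"
    "P * mat_diag n e \<in> carrier_mat n n"
    using P by auto
  have t: "?t ?P = four_block_mat (1\<^sub>m 1) (0\<^sub>m 1 n) (0\<^sub>m n 1) (?t P)"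
    using c by (subst transpose_four_block_mat) auto
  have D: "?D = four_block_mat (mat 1 1 (\<lambda>_. c)) (0\<^sub>m 1 n) (0\<^sub>m n 1) (mat_diag n e)"
    by (rule eq_matI) (auto simp: mat_diag_def split: nat.splits)
  have one: "1\<^sub>m (Suc n) = four_block_mat (1\<^sub>m 1) (0\<^sub>m 1 n) (0\<^sub>m n 1) (1\<^sub>m n :: real mat)"
    by (rule eq_matI) auto
  have [simp]: "0\<^sub>m (Suc 0) n * mat_diag n e = 0\<^sub>m (Suc 0) n" using left_mult_zero_mat[OF mat_diag_dim] .
  have [simp]: "P * mat_diag n e * 0\<^sub>m n (Suc 0) = 0\<^sub>m n (Suc 0)" by (rule right_mult_zero_mat[OF c(4)])
  note mb = mult_four_block_mat[of _ 1 1 _ n _ n _ _ 1 _ n]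
  have "?P * ?D * ?t ?P = four_block_mat (mat 1 1 (\<lambda>_. c)) (0\<^sub>m 1 n) (0\<^sub>m n 1) B"
    unfolding t D using c P by (subst mb; (auto)?)+
  moreover have "?t ?P * ?P = 1\<^sub>m (Suc n)" "?P * ?t ?P = 1\<^sub>m (Suc n)"
    unfolding t one using c P by (subst mb; (auto)?)+
  moreover have "?P \<in> carrier_mat (Suc n) (Suc n)" using c four_block_carrier_mat[of "1\<^sub>m 1" 1 1 P n n] by simp
  ultimately show ?thesis unfolding orth_diag_def by simp
qed

text \<open>Induction on the dimension. The Householder reflection \<open>H\<close> exchanging a
  unit eigenvector with \<open>e_0\<close> gives \<open>B = H M H\<close> the first column
  \<open>c e_0\<close>. By symmetry \<open>B\<close> splits into the entry \<open>c\<close> and a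
  smaller symmetric block, and conjugating back with \<open>H\<close> diagonalises
  \<open>M\<close>.\<close>

theorem spectral_theorem:
  assumes "M \<in> carrier_mat n n" "transpose_mat M = M"
  shows "\<exists>P e. orth_diag M n P e"
  using assms
proof (induction n arbitrary: M)
  case 0
  have "orth_diag M 0 (1\<^sub>m 0) (\<lambda>_. 0)" using 0 by (auto simp: orth_diag_def intro!: eq_matI)
  then show ?case by blast
next
  case (Suc n M)
  let ?n = "Suc n" let ?t = transpose_mat
  note M = Suc.prems(1)
  obtain c u where "eigenvector M u c" using symmetric_real_has_eigenvalue[OF Suc.prems] by auto
  then have u: "u \<in> carrier_vec ?n" "u \<noteq> 0\<^sub>v ?n" "M *\<^sub>v u = c \<cdot>\<^sub>v u"
    using M by (auto simp: eigenvector_def)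
  have upos: "u \<bullet> u > 0"
  proof -
    obtain i where i: "i < ?n" "u $ i \<noteq> 0" using u by (metis carrier_vecD eq_vecI index_zero_vec)
    then have "0 < (\<Sum>i<?n. u $ i * u $ i)"
      by (intro sum_pos2[where i = i]) (auto simp: zero_less_mult_iff)
    then show ?thesis using u by (simp add: scalar_prod_def lessThan_atLeast0)
  qed
  define v where "v = (1 / sqrt (u \<bullet> u)) \<cdot>\<^sub>v u"
  have v: "v \<in> carrier_vec ?n" "v \<bullet> v = 1" "M *\<^sub>v v = c \<cdot>\<^sub>v v"
    using u upos M by (auto simp: v_def smult_smult_assoc mult_mat_vec mult.commute)
  define H where "H = householder ?n v"
  have H: "H \<in> carrier_mat ?n ?n" "?t H = H" "H * H = 1\<^sub>m ?n" "col H 0 = v"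
    using householder_squared[OF v(1,2)] householder_col_0[OF v(1,2)] by (auto simp: H_def)
  define B where "B = H * M * H"
  have B: "B \<in> carrier_mat ?n ?n" using H M by (simp add: B_def)
  note tM = Suc.prems(2)
  have "?t B = H * (M * H)"
    unfolding B_def using H(1,2) M tM
    by (subst transpose_mult[of _ ?n ?n _ ?n]; (subst transpose_mult[of _ ?n ?n _ ?n])?; simp)
  then have tB: "?t B = B" using H(1) M by (simp add: B_def assoc_mult_mat[of _ ?n ?n _ ?n _ ?n])
  have "col B 0 = (H * M) *\<^sub>v col H 0"
    unfolding B_def using H(1) M by (subst col_mult2[of _ ?n ?n _ ?n]) auto
  also have "\<dots> = H *\<^sub>v (M *\<^sub>v v)"
    unfolding H(4) using assoc_mult_mat_vec[OF H(1) M v(1)] .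
  also have "\<dots> = c \<cdot>\<^sub>v (H *\<^sub>v col H 0)" unfolding v(3) H(4) by (rule mult_mat_vec[OF H(1) v(1)])
  also have "H *\<^sub>v col H 0 = unit_vec ?n 0"
    using H(1) H(3) by (metis col_mult2 col_one zero_less_Suc)
  finally have colB: "B $$ (i, 0) = (if i = 0 then c else 0)" if "i < ?n" for i
    using that B by (metis (no_types, lifting) carrier_matD index_col index_smult_vec(1) index_unit_vec(1) index_unit_vec(3) mult.right_neutral mult_zero_right zero_less_Suc)
  define B' where "B' = mat n n (\<lambda>(i, j). B $$ (Suc i, Suc j))"
  have symB: "B $$ (i, j) = B $$ (j, i)" if "i < ?n" "j < ?n" for i j
    using tB B that by (metis carrier_matD index_transpose_mat(1))
  have Bblock: "B = four_block_mat (mat 1 1 (\<lambda>_. c)) (0\<^sub>m 1 n) (0\<^sub>m n 1) B'"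
  proof (rule eq_matI)
    fix i j assume "i < dim_row (four_block_mat (mat 1 1 (\<lambda>_. c)) (0\<^sub>m 1 n) (0\<^sub>m n 1) B')"
      "j < dim_col (four_block_mat (mat 1 1 (\<lambda>_. c)) (0\<^sub>m 1 n) (0\<^sub>m n 1) B')"
    then have ij: "i < ?n" "j < ?n" by (auto simp: B'_def)
    then show "B $$ (i, j) = four_block_mat (mat 1 1 (\<lambda>_. c)) (0\<^sub>m 1 n) (0\<^sub>m n 1) B' $$ (i, j)"
      using colB[of i] colB[of j] symB[of i 0] symB[of 0 j] by (cases i; cases j) (auto simp: B'_def)
  qed (use B in \<open>auto simp: B'_def\<close>)
  have "\<exists>P e. orth_diag B' n P e"
    by (rule Suc.IH) (auto simp: B'_def symB intro!: eq_matI)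
  then obtain P e where "orth_diag B ?n P e" using orth_diag_four_block unfolding Bblock by blast
  then have "orth_diag (H * B * ?t H) ?n (H * P) e" using H by (intro orth_diag_conj) auto
  moreover have "H * B * ?t H = (H * H) * M * (H * H)"
    unfolding B_def H(2) using H(1) M by (simp add: assoc_mult_mat[of _ ?n ?n _ ?n _ ?n] del: H)
  ultimately show ?case using H(3) M by auto
qed

context
  fixes M P :: "real mat" and n :: nat and e :: "nat \<Rightarrow> real"
  assumes od: "orth_diag M n P e"
begin

lemma orth_diag_char_poly: "char_poly M = (\<Prod>i<n. [:- e i, 1:])"
proof -
  have P: "P \<in> carrier_mat n n" "M \<in> carrier_mat n n" using od by (auto simp: orth_diag_def)
  have "similar_mat M (mat_diag n e)"
    using od P unfolding orth_diag_def similar_mat_def similar_mat_wit_def Let_def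
    by (intro exI[of _ P] exI[of _ "transpose_mat P"]) auto
  then have "char_poly M = char_poly (mat_diag n e)" by (rule char_poly_similar)
  also have "\<dots> = (\<Prod>a\<leftarrow>diag_mat (mat_diag n e). [:- a, 1:])"
    by (rule char_poly_upper_triangular[of _ n]) (auto simp: upper_triangular_def mat_diag_def)
  also have "diag_mat (mat_diag n e) = map e [0..<n]"
    by (auto simp: diag_mat_def mat_diag_def)
  finally show ?thesis
    by (simp add: prod.list_conv_set_nth lessThan_atLeast0)
qed

text \<open>In the eigenbasis coordinates \<open>z\<close> the hypotheses say that the nonnegative
  terms \<open>(T - e i) * (z $ i)\<^sup>2\<close> have a nonpositive sum, so each vanishes and
  \<open>z\<close> is supported where \<open>e i = T\<close>. This one statement serves both the
  bound on the largest eigenvalue and its equality case.\<close>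

lemma orth_diag_rayleigh_eq:
  assumes x: "x \<in> carrier_vec n" and le: "\<And>i. i < n \<Longrightarrow> e i \<le> T"
    and ge: "x \<bullet> (M *\<^sub>v x) \<ge> T * (x \<bullet> x)"
  shows "M *\<^sub>v x = T \<cdot>\<^sub>v x"
proof -
  let ?t = transpose_mat
  have P: "P \<in> carrier_mat n n" "?t P \<in> carrier_mat n n" "M \<in> carrier_mat n n" and D: "mat_diag n e \<in> carrier_mat n n"
    and PP: "P * ?t P = 1\<^sub>m n" and M: "M = P * mat_diag n e * ?t P"
    using od by (auto simp: orth_diag_def)
  define z where "z = ?t P *\<^sub>v x"
  have z: "z \<in> carrier_vec n" using P x by (simp add: z_def)
  have Pz: "P *\<^sub>v z = x" unfolding z_def using P x PP by (metis assoc_mult_mat_vec one_mult_mat_vec)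
  have Dz: "mat_diag n e *\<^sub>v z = vec n (\<lambda>i. e i * z $ i)"
    using z by (intro eq_vecI) (auto simp: mat_diag_def scalar_prod_def if_distrib[of "\<lambda>x. x * _"] cong: if_cong)
  have Mx: "M *\<^sub>v x = P *\<^sub>v vec n (\<lambda>i. e i * z $ i)"
  proof -
    have "M *\<^sub>v x = P *\<^sub>v (mat_diag n e *\<^sub>v z)"
      unfolding M z_def using P D x by (simp add: assoc_mult_mat_vec[of _ n n _ n])
    then show ?thesis by (simp only: Dz)
  qed
  have adj: "x \<bullet> (P *\<^sub>v y) = z \<bullet> y" if y: "y \<in> carrier_vec n" for y
    unfolding z_def using P x y by (metis transpose_vec_mult_scalar comm_scalar_prod mult_mat_vec_carrier)
  have "x \<bullet> (M *\<^sub>v x) = (\<Sum>i<n. e i * (z $ i)\<^sup>2)"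
    unfolding Mx using z by (subst adj) (auto simp: scalar_prod_def power2_eq_square lessThan_atLeast0 intro!: sum.cong)
  moreover have "x \<bullet> x = (\<Sum>i<n. (z $ i)\<^sup>2)"
    using adj[OF z] z unfolding Pz by (simp add: scalar_prod_def power2_eq_square lessThan_atLeast0)
  ultimately have "(\<Sum>i<n. (T - e i) * (z $ i)\<^sup>2) \<le> 0"
    using ge by (simp add: sum_subtractf sum_distrib_left algebra_simps)
  moreover have nn: "(T - e i) * (z $ i)\<^sup>2 \<ge> 0" if "i < n" for i
    using le[OF that] by simp
  ultimately have "(\<Sum>i<n. (T - e i) * (z $ i)\<^sup>2) = 0"
    by (intro antisym sum_nonneg) auto
  then have "(T - e i) * (z $ i)\<^sup>2 = 0" if "i < n" for i
    using nn that sum_nonneg_eq_0_iff[of "{..<n}" "\<lambda>i. (T - e i) * (z $ i)\<^sup>2"] by simp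
  then have "e i * z $ i = T * z $ i" if "i < n" for i
    using that by fastforce
  then have "vec n (\<lambda>i. e i * z $ i) = T \<cdot>\<^sub>v z" using z by (intro eq_vecI) auto
  then show ?thesis using Mx Pz P z by (metis mult_mat_vec)
qed

lemma orth_diag_trace: "(\<Sum>i<n. M $$ (i, i)) = (\<Sum>i<n. e i)"
proof -
  have P: "P \<in> carrier_mat n n" "transpose_mat P \<in> carrier_mat n n"
    and M: "M = P * mat_diag n e * transpose_mat P" and PP: "transpose_mat P * P = 1\<^sub>m n"
    using od by (auto simp: orth_diag_def)
  have "M $$ (i, i) = (\<Sum>k<n. e k * (P $$ (i, k) * P $$ (i, k)))" if "i < n" for i
    unfolding M mat_diag_mult_right[OF P(1)] using P that
    by (auto simp: scalar_prod_def lessThan_atLeast0 intro!: sum.cong)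
  then have "(\<Sum>i<n. M $$ (i, i)) = (\<Sum>i<n. \<Sum>k<n. e k * (P $$ (i, k) * P $$ (i, k)))"
    by (intro sum.cong) auto
  also have "\<dots> = (\<Sum>k<n. e k * (\<Sum>i<n. P $$ (i, k) * P $$ (i, k)))"
    by (subst sum.swap) (simp add: sum_distrib_left)
  also have "\<dots> = (\<Sum>k<n. e k)"
  proof (intro sum.cong refl)
    fix k assume k: "k \<in> {..<n}"
    have "(\<Sum>i<n. P $$ (i, k) * P $$ (i, k)) = (transpose_mat P * P) $$ (k, k)"
      using P k by (auto simp: scalar_prod_def lessThan_atLeast0 intro!: sum.cong)
    then show "e k * (\<Sum>i<n. P $$ (i, k) * P $$ (i, k)) = e k" using k PP by simp
  qed
  finally show ?thesis .
qed

end

section \<open>The sorted list of eigenvalues\<close>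

lemma proots_prod_linear: "proots (\<Prod>i<n. [:- e i, 1:]) = image_mset e (mset_set {..<n})"
  for e :: "nat \<Rightarrow> real"
  by (induction n) (simp_all add: proots_mult lessThan_Suc del: mult_pCons_left mult_pCons_right)

text \<open>The sorted list and the diagonal from the spectral theorem are the same multiset, the
  roots of the characteristic polynomial, so symmetric expressions and upper bounds carry
  over.\<close>

lemma symmetric_eigenvalues_desc:
  fixes M :: "real mat"
  assumes M: "M \<in> carrier_mat n n" "transpose_mat M = M"
  defines "xs \<equiv> eigenvalues_desc M"
  shows "length xs = n"
    and "\<And>i j. i \<le> j \<Longrightarrow> j < n \<Longrightarrow> xs ! j \<le> xs ! i"
    and "char_poly M = (\<Prod>i<n. [:- (xs ! i), 1:])"
    and "(\<Sum>i<n. xs ! i) = (\<Sum>i<n. M $$ (i, i))"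
    and "\<And>x T. x \<in> carrier_vec n \<Longrightarrow> n > 0 \<Longrightarrow> xs ! 0 \<le> T \<Longrightarrow> T * (x \<bullet> x) \<le> x \<bullet> (M *\<^sub>v x) \<Longrightarrow>
           M *\<^sub>v x = T \<cdot>\<^sub>v x"
proof -
  obtain P e where od: "orth_diag M n P e" using spectral_theorem[OF M] by auto
  have ms: "mset xs = image_mset e (mset_set {..<n})"
    unfolding xs_def eigenvalues_desc_def orth_diag_char_poly[OF od] proots_prod_linear by simp
  have "size (mset xs) = n" unfolding ms by simp
  then show len: "length xs = n" by simp
  have mxs: "mset xs = image_mset ((!) xs) (mset_set {..<n})"
    using len by (metis atLeast_upt map_nth mset_map mset_set_upto_eq_mset_upto)
  have "sorted (rev xs)" by (simp add: xs_def eigenvalues_desc_def)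
  then show desc: "xs ! j \<le> xs ! i" if "i \<le> j" "j < n" for i j
    using that len sorted_rev_nth_mono by metis
  have "(\<Prod>i<n. [:- (xs ! i), 1:]) = prod_mset (image_mset (\<lambda>x. [:- x, 1:]) (mset xs))"
    unfolding mxs by (simp add: prod_unfold_prod_mset multiset.map_comp comp_def)
  also have "\<dots> = (\<Prod>i<n. [:- e i, 1:])"
    unfolding ms by (simp add: prod_unfold_prod_mset multiset.map_comp comp_def)
  finally show "char_poly M = (\<Prod>i<n. [:- (xs ! i), 1:])"
    using orth_diag_char_poly[OF od] by simp
  have "(\<Sum>i<n. xs ! i) = sum_mset (mset xs)"
    unfolding mxs by (simp add: sum_unfold_sum_mset)
  also have "\<dots> = (\<Sum>i<n. e i)"
    unfolding ms by (simp add: sum_unfold_sum_mset)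
  finally show "(\<Sum>i<n. xs ! i) = (\<Sum>i<n. M $$ (i, i))"
    using orth_diag_trace[OF od] by simp
  fix x T assume x: "x \<in> carrier_vec n" "n > 0" "xs ! 0 \<le> T" "T * (x \<bullet> x) \<le> x \<bullet> (M *\<^sub>v x)"
  have "e i \<le> T" if "i < n" for i
  proof -
    have "e i \<in># mset xs" unfolding ms using that by simp
    then obtain j where "j < n" "e i = xs ! j" using len by (auto simp: in_set_conv_nth)
    then show ?thesis using desc[of 0 j] x(3) by simp
  qed
  then show "M *\<^sub>v x = T \<cdot>\<^sub>v x" using orth_diag_rayleigh_eq[OF od x(1) _ x(4)] by blast
qed

section \<open>Lower bounds for power sums\<close>

text \<open>The AM-GM inequality in logarithmic form: the tangent of \<open>exp\<close> at the mean
  \<open>m\<close> lies below \<open>exp\<close>, and its linear parts cancel in the sum.\<close>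

lemma exp_mean_le_sum:
  fixes w :: "'i \<Rightarrow> real"
  assumes "finite I" and "(\<Sum>i\<in>I. w i) = real (card I) * m"
  shows "real (card I) * exp m \<le> (\<Sum>i\<in>I. exp (w i))"
proof -
  have "exp m * (1 + (w i - m)) \<le> exp (w i)" for i
    using mult_left_mono[OF exp_ge_add_one_self[of "w i - m"], of "exp m"]
    by (simp flip: exp_add)
  then have "(\<Sum>i\<in>I. exp m * (1 + (w i - m))) \<le> (\<Sum>i\<in>I. exp (w i))"
    by (intro sum_mono)
  also have "(\<Sum>i\<in>I. exp m * (1 + (w i - m))) = real (card I) * exp m"
    using assms by (simp add: sum.distrib sum_subtractf flip: sum_distrib_left)
  finally show ?thesis .
qed

text \<open>Up to a positive factor this is the function \<open>f\<close> of the introduction, with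
  \<open>\<beta> = \<alpha>\<close> and \<open>M = N - 1\<close>, in the variable
  \<open>ln x\<close> measured from the logarithm of the geometric mean. For a positive argument the
  difference in the derivative has the sign of \<open>\<beta>\<close>.\<close>

lemma exp_balance_strict_mono:
  fixes \<beta> M s t :: real
  assumes "\<beta> \<noteq> 0" "M > 0" "0 \<le> s" "s < t"
  shows "exp (\<beta> * s) + M * exp (- \<beta> * s / M) < exp (\<beta> * t) + M * exp (- \<beta> * t / M)"
proof (rule DERIV_pos_imp_increasing_open[OF \<open>s < t\<close>])
  fix x assume x: "s < x" "x < t"
  have "((\<lambda>x. exp (\<beta> * x) + M * exp (- \<beta> * x / M)) has_real_derivative
          \<beta> * (exp (\<beta> * x) - exp (- \<beta> * x / M))) (at x)"
    using assms by (auto intro!: derivative_eq_intros simp: field_simps)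
  moreover have "\<beta> * (exp (\<beta> * x) - exp (- \<beta> * x / M)) > 0"
  proof (cases "\<beta> > 0")
    case True
    then have "- \<beta> * x / M < 0" "0 < \<beta> * x" using assms x by (auto simp: field_simps mult_pos_pos)
    then have "exp (- \<beta> * x / M) < exp (\<beta> * x)" by simp
    with True show ?thesis by simp
  next
    case False
    then have "\<beta> < 0" using assms by simp
    then have neg: "\<beta> * x < 0" using assms x by (auto intro: mult_neg_pos)
    then have "- \<beta> * x / M > 0" using assms by (simp add: divide_neg_pos)
    with neg have "exp (- \<beta> * x / M) > exp (\<beta> * x)" by simp
    with \<open>\<beta> < 0\<close> show ?thesis by (simp add: mult_neg_neg)
  qed
  ultimately show "\<exists>y. ((\<lambda>x. exp (\<beta> * x) + M * exp (- \<beta> * x / M)) has_real_derivative y) (at x)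
      \<and> y > 0" by blast
next
  show "continuous_on {s..t} (\<lambda>x. exp (\<beta> * x) + M * exp (- \<beta> * x / M))"
    using assms by (intro continuous_intros) auto
qed

text \<open>With \<open>y = exp z\<close> this is \<open>y + k \<ge> (k + 1) y^(1/(k+1))\<close>.
  The gap is a combination of two remainders of \<open>1 + x \<le> exp x\<close>, at
  \<open>k * w\<close> and at \<open>- w\<close>; the second is positive for
  \<open>w \<noteq> 0\<close> and gives strictness when \<open>k > 0\<close>.\<close>

lemma exp_bernoulli:
  fixes k z :: real
  assumes "k \<ge> 0"
  shows "(k + 1) * exp (z / (k + 1)) - k \<le> exp z"
    and "k > 0 \<Longrightarrow> z \<noteq> 0 \<Longrightarrow> (k + 1) * exp (z / (k + 1)) - k < exp z"
proof -
  define w where "w = z / (k + 1)"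
  have z: "z = w + k * w" using assms by (simp add: w_def divide_simps) (simp add: algebra_simps)
  have id: "exp z - ((k + 1) * exp w - k) =
      exp w * (exp (k * w) - (1 + k * w)) + k * exp w * (exp (- w) - (1 + (- w)))"
    unfolding z exp_add by (simp add: algebra_simps flip: exp_add)
  have a: "exp w * (exp (k * w) - (1 + k * w)) \<ge> 0"
    using exp_ge_add_one_self[of "k * w"] by simp
  have "k * exp w * (exp (- w) - (1 + (- w))) \<ge> 0"
    using exp_ge_add_one_self[of "- w"] assms by simp
  with a id show "(k + 1) * exp (z / (k + 1)) - k \<le> exp z"
    unfolding w_def[symmetric] by linarith
  assume k: "k > 0" and "z \<noteq> 0"
  then have "w \<noteq> 0" using z by auto
  then have "1 + (- w) < exp (- w)"
    using exp_ge_add_one_self[of "- w"] exp_minus_ge ln_eq_minus_one[of "exp (- w)"]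
    by (metis add.commute add_diff_cancel_left' exp_eq_one_iff exp_gt_zero ln_exp
        neg_equal_0_iff_equal order_le_less)
  then have "k * exp w * (exp (- w) - (1 + (- w))) > 0" using k by simp
  with a id show "(k + 1) * exp (z / (k + 1)) - k < exp z"
    unfolding w_def[symmetric] by linarith
qed

text \<open>The geometric mean is at most the arithmetic mean, which is below
  \<open>T\<close>.\<close>

lemma ln_prod_less_if_sum_less:
  fixes x :: "nat \<Rightarrow> real"
  assumes "N > 0" "\<And>i. i < N \<Longrightarrow> x i > 0" "(\<Sum>i<N. x i) < real N * T"
  shows "ln (\<Prod>i<N. x i) / N < ln T"
proof -
  define m where "m = ln (\<Prod>i<N. x i) / N"
  have "(\<Sum>i<N. ln (x i)) = ln (\<Prod>i<N. x i)"
    using assms(2) by (subst ln_prod) (auto simp: less_imp_neq[symmetric])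
  then have "real (card {..<N}) * exp m \<le> (\<Sum>i<N. exp (ln (x i)))"
    using assms(1) by (intro exp_mean_le_sum) (auto simp: m_def)
  also have "\<dots> = (\<Sum>i<N. x i)" using assms(2) by (intro sum.cong) auto
  also have "\<dots> < real N * T" by fact
  finally have "exp m < T" using assms(1) by simp
  then show ?thesis unfolding m_def by (metis exp_gt_zero exp_less_cancel_iff exp_ln order.strict_trans)
qed

lemma power_sum_lower_bound:
  fixes x :: "nat \<Rightarrow> real" and \<alpha> k T p :: real and N :: nat
  assumes N: "N \<ge> 2" and pos: "\<And>i. i < N \<Longrightarrow> x i > 0" and p: "p = (\<Prod>i<N. x i)"
    and T: "T > 0" "x 0 \<ge> T" and sum: "(\<Sum>i<N. x i) < real N * T"
    and \<alpha>: "\<alpha> \<noteq> 0" and k: "k \<ge> 0"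
  defines "R \<equiv> (real N - 1) * p powr (\<alpha> / real N) *
              ((k + 1) * p powr (\<alpha> / ((k + 1) * real N * (real N - 1)))
                 / T powr (\<alpha> / ((k + 1) * (real N - 1))) - k) + T powr \<alpha>"
  shows "R \<le> (\<Sum>i<N. x i powr \<alpha>)" and "x 0 > T \<or> k > 0 \<Longrightarrow> R < (\<Sum>i<N. x i powr \<alpha>)"
proof -
  \<comment> \<open>Logarithms are taken relative to the geometric mean: \<open>m\<close> is its
    logarithm, \<open>\<tau>\<close> and \<open>s\<close> are the offsets of \<open>T\<close> and
    \<open>x 0\<close>, and \<open>c = p powr (\<alpha> / N)\<close> is factored out. The proof is
    the chain of \<open>R\<close>, \<open>c * h \<tau>\<close>, \<open>c * h s\<close> and the power
    sum, by Bernoulli, monotonicity and AM-GM. The first link is strict if \<open>k > 0\<close>, the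
    second if \<open>x 0 > T\<close>.\<close>
  define M where "M = real N - 1"
  define m where "m = ln p / N"
  define \<tau> where "\<tau> = ln T - m"
  define s where "s = ln (x 0) - m"
  define c where "c = exp (\<alpha> * m)"
  define h where "h t = exp (\<alpha> * t) + M * exp (- \<alpha> * t / M)" for t
  have M: "M > 0" using N by (simp add: M_def)
  have x0: "x 0 > 0" using pos N by simp
  have ppos: "p > 0" unfolding p by (intro prod_pos) (use pos in auto)
  have lnp: "ln p = real N * m" using N by (simp add: m_def)
  have "m < ln T" unfolding m_def p using ln_prod_less_if_sum_less[of N x T] N pos sum by simp
  then have \<tau>: "\<tau> > 0" by (simp add: \<tau>_def)
  have "\<tau> \<le> s" and \<tau>s: "x 0 > T \<Longrightarrow> \<tau> < s" using T x0 by (simp_all add: \<tau>_def s_def)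
  have split: "{..<N} = insert 0 {1..<N}" using N by auto
  have "(\<Sum>i<N. ln (x i)) = ln p" unfolding p using pos by (subst ln_prod) (auto simp: less_imp_neq[symmetric])
  then have "(\<Sum>i=1..<N. ln (x i)) = ln p - ln (x 0)" by (simp add: split)
  then have "(\<Sum>i=1..<N. \<alpha> * ln (x i)) = real (card {1..<N}) * (\<alpha> * (ln p - ln (x 0)) / M)"
    using N M by (simp add: M_def of_nat_diff flip: sum_distrib_left)
  from exp_mean_le_sum[OF _ this]
  have "M * exp (\<alpha> * (ln p - ln (x 0)) / M) \<le> (\<Sum>i=1..<N. exp (\<alpha> * ln (x i)))"
    using N by (simp add: M_def of_nat_diff)
  also have "\<dots> = (\<Sum>i=1..<N. x i powr \<alpha>)"
    using pos by (intro sum.cong) (auto simp: powr_def less_imp_neq[symmetric])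
  finally have amgm: "x 0 powr \<alpha> + M * exp (\<alpha> * (ln p - ln (x 0)) / M) \<le> (\<Sum>i<N. x i powr \<alpha>)"
    by (simp add: split)
  have "\<alpha> * (ln p - ln (x 0)) / M = \<alpha> * m + - \<alpha> * s / M"
    using M by (simp add: lnp s_def M_def field_simps)
  then have "M * exp (\<alpha> * (ln p - ln (x 0)) / M) = c * (M * exp (- \<alpha> * s / M))"
    by (simp only: exp_add c_def mult.left_commute)
  moreover have "x 0 powr \<alpha> = c * exp (\<alpha> * s)"
    using x0 by (simp add: powr_def c_def s_def algebra_simps flip: exp_add)
  ultimately have lower: "c * h s \<le> (\<Sum>i<N. x i powr \<alpha>)"
    using amgm by (simp only: h_def distrib_left)
  have c: "c > 0" by (simp add: c_def)
  \<comment> \<open>\<open>c * exp z\<close> equals \<open>(p / T) powr (\<alpha> / M)\<close>, the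
    common \<open>\<alpha>\<close>-th power of the other eigenvalues in the extremal case with
    largest eigenvalue \<open>T\<close>. As \<open>T\<close> lies strictly above the geometric mean,
    \<open>z \<noteq> 0\<close>, which the strict Bernoulli inequality requires.\<close>
  define z where "z = - \<alpha> * \<tau> / M"
  have z: "z \<noteq> 0" using \<alpha> \<tau> M by (simp add: z_def)
  have "p powr (\<alpha> / real N) = c" using ppos N by (simp add: powr_def c_def m_def)
  moreover have "p powr (\<alpha> / ((k + 1) * real N * M)) / T powr (\<alpha> / ((k + 1) * M)) = exp (z / (k + 1))"
  proof -
    have "\<alpha> / ((k + 1) * real N * M) * ln p - \<alpha> / ((k + 1) * M) * ln T = z / (k + 1)"
    proof -
      have "\<alpha> / ((k + 1) * real N * M) * ln p = \<alpha> * m / ((k + 1) * M)"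
        using N by (simp add: lnp)
      moreover have "z / (k + 1) = - \<alpha> * \<tau> / ((k + 1) * M)" by (simp add: z_def mult.commute)
      ultimately show ?thesis by (simp add: \<tau>_def algebra_simps flip: diff_divide_distrib add_divide_distrib)
    qed
    then show ?thesis using ppos T(1) by (simp add: powr_def flip: exp_diff)
  qed
  moreover have "T powr \<alpha> = c * exp (\<alpha> * \<tau>)"
    using T(1) by (simp add: powr_def c_def \<tau>_def algebra_simps flip: exp_add)
  ultimately have R: "R = c * (exp (\<alpha> * \<tau>) + M * ((k + 1) * exp (z / (k + 1)) - k))"
    unfolding R_def M_def[symmetric] times_divide_eq_right[symmetric]
    by (simp only:) (simp add: algebra_simps)
  have h\<tau>: "h \<tau> = exp (\<alpha> * \<tau>) + M * exp z" by (simp add: h_def z_def)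
  have Rle: "R \<le> c * h \<tau>"
    unfolding R h\<tau> using exp_bernoulli(1)[OF k, of z] c M by simp
  have hle: "h \<tau> \<le> h s"
    using exp_balance_strict_mono[OF \<alpha> M, of \<tau> s] \<tau> \<open>\<tau> \<le> s\<close> by (cases "\<tau> = s") (auto simp: h_def)
  show "R \<le> (\<Sum>i<N. x i powr \<alpha>)" using Rle hle lower c
    by (meson mult_left_mono order.trans less_imp_le)
  assume "x 0 > T \<or> k > 0"
  then show "R < (\<Sum>i<N. x i powr \<alpha>)"
  proof
    assume "x 0 > T"
    then have "h \<tau> < h s"
      using exp_balance_strict_mono[OF \<alpha> M, of \<tau> s] \<tau> \<tau>s by (auto simp: h_def)
    then have "c * h \<tau> < c * h s" using c by simp
    with Rle lower show ?thesis by simp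
  next
    assume "k > 0"
    then have "R < c * h \<tau>" unfolding R h\<tau> using exp_bernoulli(2)[OF k _ z] c M by simp
    also have "\<dots> \<le> c * h s" using hle c by simp
    finally show ?thesis using lower by simp
  qed
qed

section \<open>Laplacian and signless Laplacian matrices\<close>

definition slap :: "'a ugraph \<Rightarrow> 'a \<Rightarrow> 'a \<Rightarrow> real" where
  "slap G u v = (if u = v then real (vdegree G u) else 0) + (if adj G u v then 1 else 0)"

lemma transpose_vmat_slap: "transpose_mat (vmat vs (slap G)) = vmat vs (slap G)"
  by (rule eq_matI) (auto simp: vmat_def slap_def adj_sym)

lemma vertex_list:
  assumes "simple_graph G"
  shows "distinct (vertex_list G)" "set (vertex_list G) = verts G"
    "length (vertex_list G) = card (verts G)"
proof -
  have "\<exists>vs. distinct vs \<and> set vs = verts G"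
    using assms finite_distinct_list[of "verts G"] by (auto simp: simple_graph_def)
  then have "distinct (vertex_list G) \<and> set (vertex_list G) = verts G"
    unfolding vertex_list_def by (rule someI_ex)
  then show "distinct (vertex_list G)" "set (vertex_list G) = verts G"
    "length (vertex_list G) = card (verts G)"
    by (auto simp flip: distinct_card)
qed

lemma laplacian_mat_eq_vmat:
  assumes "simple_graph G"
  shows "laplacian_mat G = vmat (vertex_list G) (lap G)"
    and "signless_laplacian_mat G = vmat (vertex_list G) (slap G)"
  using vertex_list[OF assms]
  by (auto simp: laplacian_mat_def signless_laplacian_mat_def degree_mat_def adjacency_mat_def
      vmat_def lap_def slap_def nth_eq_iff_index_eq intro!: eq_matI)

text \<open>Two enumerations of the same vertices differ by a permutation \<open>\<sigma>\<close> of
  positions, so the matrices are similar by the permutation matrix \<open>P\<close>. The arbitrary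
  \<open>vertex_list\<close> can therefore be replaced by a convenient list.\<close>

lemma char_poly_vmat_cong:
  assumes vs: "distinct vs" and ws: "distinct ws" and eq: "set vs = set ws"
  shows "char_poly (vmat vs h) = char_poly (vmat ws h)"
proof -
  define n where "n = length vs"
  have lw: "length ws = n" using assms by (metis distinct_card n_def)
  have "\<exists>j<n. ws ! j = vs ! i" if "i < n" for i
    using that eq lw by (metis in_set_conv_nth n_def)
  then obtain \<sigma> where \<sigma>: "\<And>i. i < n \<Longrightarrow> \<sigma> i < n" "\<And>i. i < n \<Longrightarrow> ws ! \<sigma> i = vs ! i" by metis
  have inj: "\<sigma> i = \<sigma> j \<longleftrightarrow> i = j" if "i < n" "j < n" for i j
    using that \<sigma> vs by (metis n_def nth_eq_iff_index_eq)
  define P :: "real mat" where "P = mat n n (\<lambda>(i, j). if j = \<sigma> i then 1 else 0)"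
  have P: "P \<in> carrier_mat n n" by (simp add: P_def)
  have PX: "(P * X) $$ (i, j) = X $$ (\<sigma> i, j)" if "X \<in> carrier_mat n n" "i < n" "j < n" for X i j
    using that \<sigma> by (simp add: P_def scalar_prod_def if_distrib[of "\<lambda>x. x * _"] cong: if_cong)
  have PXP: "(P * X * transpose_mat P) $$ (i, j) = X $$ (\<sigma> i, \<sigma> j)"
    if "X \<in> carrier_mat n n" "i < n" "j < n" for X i j
  proof -
    have "(Y * transpose_mat P) $$ (i, j) = (\<Sum>k<n. Y $$ (i, k) * P $$ (j, k))"
      if "Y \<in> carrier_mat n n" for Y
      using that P \<open>i < n\<close> \<open>j < n\<close> by (auto simp: scalar_prod_def lessThan_atLeast0)
    then have "(P * X * transpose_mat P) $$ (i, j) = (\<Sum>k<n. (P * X) $$ (i, k) * P $$ (j, k))"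
      using that P by (metis mult_carrier_mat)
    also have "\<dots> = (\<Sum>k<n. if k = \<sigma> j then (P * X) $$ (i, k) else 0)"
      using that by (intro sum.cong) (auto simp: P_def)
    finally show ?thesis using that \<sigma> PX by simp
  qed
  have id: "P * transpose_mat P = 1\<^sub>m n"
    using PXP[of "1\<^sub>m n"] inj \<sigma>(1) P by (intro eq_matI) auto
  have "similar_mat_wit (vmat vs h) (vmat ws h) P (transpose_mat P)"
    unfolding similar_mat_wit_def Let_def
  proof (intro conjI)
    show "vmat vs h = P * vmat ws h * transpose_mat P"
      using PXP[of "vmat ws h"] \<sigma> P lw by (intro eq_matI) (auto simp: vmat_def n_def[symmetric])
    show "transpose_mat P * P = 1\<^sub>m (dim_row (vmat vs h))"
      using mat_mult_left_right_inverse[OF P _ id] P by (simp add: vmat_def n_def)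
  qed (use id P lw in \<open>auto simp: vmat_def n_def\<close>)
  then show ?thesis by (intro char_poly_similar) (auto simp: similar_mat_def)
qed

lemma char_poly_block_upper_triangular:
  fixes A B D :: "real mat"
  assumes "A \<in> carrier_mat n n" "B \<in> carrier_mat n m" "D \<in> carrier_mat m m"
  shows "char_poly (four_block_mat A B (0\<^sub>m m n) D) = char_poly A * char_poly D"
proof -
  have "char_poly_matrix (four_block_mat A B (0\<^sub>m m n) D) =
      four_block_mat (char_poly_matrix A) (map_mat (\<lambda>a. [:- a:]) B) (0\<^sub>m m n) (char_poly_matrix D)"
    using assms by (intro eq_matI) (auto simp: char_poly_matrix_def)
  then show ?thesis unfolding char_poly_def
    using assms by (simp add: det_four_block_mat_lower_left_zero[of _ n _ m])
qed

section \<open>The double cover of a graph\<close>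

lemma adj_K2: "adj K2 x y \<longleftrightarrow> x \<noteq> y"
  by (cases x; cases y) (auto simp: adj_def K2_def doubleton_eq_iff)

lemma adj_graph_prod: "adj (graph_prod G H) (u, x) (v, y) \<longleftrightarrow> adj G u v \<and> adj H x y"
  by (subst adj_def) (auto simp: graph_prod_def doubleton_eq_iff adj_sym)

lemma simple_graph_prod_K2:
  assumes G: "simple_graph G"
  shows "simple_graph (graph_prod G K2)"
proof -
  have "finite (verts (graph_prod G K2))" using G by (auto simp: graph_prod_def simple_graph_def)
  moreover have "edges (graph_prod G K2) \<subseteq>
      {{p, q} | p q. p \<in> verts (graph_prod G K2) \<and> q \<in> verts (graph_prod G K2) \<and> p \<noteq> q}"
    using simple_adjD[OF G] by (fastforce simp: graph_prod_def K2_def)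
  ultimately show ?thesis unfolding simple_graph_def by blast
qed

lemma vdegree_prod_K2: "vdegree (graph_prod G K2) (u, x) = vdegree G u"
proof -
  have "{p \<in> verts (graph_prod G K2). adj (graph_prod G K2) (u, x) p} =
      (\<lambda>v. (v, \<not> x)) ` {v \<in> verts G. adj G u v}"
    by (auto simp: adj_graph_prod adj_K2) (auto simp: graph_prod_def K2_def)
  then show ?thesis by (simp add: vdegree_def card_image inj_on_def)
qed

lemma lap_prod_K2:
  "lap (graph_prod G K2) (u, x) (v, y) =
     (if u = v \<and> x = y then real (vdegree G u) else 0) - (if adj G u v \<and> x \<noteq> y then 1 else 0)"
  by (simp add: lap_def vdegree_prod_K2 adj_graph_prod adj_K2)

text \<open>Listing the two copies of the vertices one after the other gives the block matrix with
  \<open>D\<close> on the diagonal and \<open>- A\<close> off it. The unipotent matrix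
  \<open>P\<close> makes it similar to a block triangular matrix with diagonal blocks
  \<open>S = D + A\<close> and \<open>L = D - A\<close>.\<close>

lemma char_poly_lap_prod_K2:
  assumes G: "simple_graph G" and vs: "distinct vs" "set vs = verts G"
  shows "char_poly (laplacian_mat (graph_prod G K2)) =
    char_poly (vmat vs (lap G)) * char_poly (vmat vs (slap G))"
proof -
  let ?G2 = "graph_prod G K2"
  note G2 = simple_graph_prod_K2[OF G]
  define n where "n = length vs"
  define ws where "ws = map (\<lambda>v. (v, False)) vs @ map (\<lambda>v. (v, True)) vs"
  have ws: "distinct ws" "set ws = verts ?G2"
    using vs by (auto simp: ws_def distinct_map inj_on_def graph_prod_def K2_def)
  define A where "A = vmat vs (\<lambda>u v. if adj G u v then 1 else 0)"
  define D where "D = vmat vs (\<lambda>u v. if u = v then real (vdegree G u) else 0)"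
  define L where "L = vmat vs (lap G)"
  define S where "S = vmat vs (slap G)"
  have c: "A \<in> carrier_mat n n" "D \<in> carrier_mat n n" "L \<in> carrier_mat n n" "S \<in> carrier_mat n n"
    by (simp_all add: A_def D_def L_def S_def n_def)
  define P :: "real mat" where "P = four_block_mat (1\<^sub>m n) (0\<^sub>m n n) (- 1\<^sub>m n) (1\<^sub>m n)"
  define P' :: "real mat" where "P' = four_block_mat (1\<^sub>m n) (0\<^sub>m n n) (1\<^sub>m n) (1\<^sub>m n)"
  have P: "P \<in> carrier_mat (n + n) (n + n)" "P' \<in> carrier_mat (n + n) (n + n)"
    unfolding P_def P'_def by (rule four_block_carrier_mat; simp)+
  have one: "1\<^sub>m (n + n) = four_block_mat (1\<^sub>m n) (0\<^sub>m n n) (0\<^sub>m n n) (1\<^sub>m n :: real mat)"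
    by (rule eq_matI) auto
  have [simp]: "1\<^sub>m n + - 0\<^sub>m n n = (1\<^sub>m n :: real mat)" "1\<^sub>m n + - 1\<^sub>m n = (0\<^sub>m n n :: real mat)"
    by (rule eq_matI; auto)+
  have [simp]: "- 1\<^sub>m n + 1\<^sub>m n = (0\<^sub>m n n :: real mat)" by (rule eq_matI) auto
  note mb = mult_four_block_mat[of _ n n _ n _ n _ _ n _ n]
  let ?B = "four_block_mat S (- A) (0\<^sub>m n n) L"
  have M: "vmat ws (lap ?G2) = four_block_mat D (- A) (- A) D"
    using vs by (intro eq_matI)
      (auto simp: vmat_def ws_def D_def A_def nth_append lap_prod_K2 nth_eq_iff_index_eq)
  have PB: "P * ?B = four_block_mat S (- A) (- S) D"
  proof -
    have "A + L = D" using c unfolding A_def L_def D_def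
      by (intro eq_matI) (auto simp: vmat_def lap_def)
    moreover have "- 1\<^sub>m n * X = - X" if "X \<in> carrier_mat n n" for X :: "real mat"
      using that by simp
    ultimately show ?thesis unfolding P_def using c by (subst mb) auto
  qed
  have "P * ?B * P' = four_block_mat D (- A) (- A) D"
  proof -
    have "S + - A = D" "- S + D = - A" using c unfolding A_def S_def D_def
      by (auto simp: vmat_def slap_def intro!: eq_matI)
    then show ?thesis unfolding PB P'_def using c by (subst mb) auto
  qed
  moreover have "P * P' = 1\<^sub>m (n + n)"
    unfolding P_def P'_def one by (subst mb) auto
  moreover have "P' * P = 1\<^sub>m (n + n)"
    unfolding P_def P'_def one by (subst mb) auto
  ultimately have "similar_mat_wit (vmat ws (lap ?G2)) ?B P P'"
    unfolding similar_mat_wit_def Let_def M using P c by auto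
  then have "char_poly (vmat ws (lap ?G2)) = char_poly ?B"
    by (intro char_poly_similar) (auto simp: similar_mat_def)
  also have "\<dots> = char_poly S * char_poly L"
    using c by (intro char_poly_block_upper_triangular) auto
  finally show ?thesis
    unfolding laplacian_mat_eq_vmat(1)[OF G2] L_def S_def
    using char_poly_vmat_cong[OF vertex_list(1)[OF G2] ws(1)] vertex_list(2)[OF G2] ws(2)
    by (simp add: mult.commute)
qed

text \<open>Conjugation by the diagonal matrix with entry 1 on \<open>A\<close> and -1 elsewhere
  fixes the degrees and flips the sign of every adjacency entry, since edges join the two
  classes.\<close>

lemma char_poly_lap_eq_slap_if_bipartite:
  assumes G: "simple_graph G" and bip: "bipartite_graph G" and vs: "distinct vs"
  shows "char_poly (vmat vs (lap G)) = char_poly (vmat vs (slap G))"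
proof -
  obtain A B where AB: "A \<inter> B = {}" "\<And>e. e \<in> edges G \<Longrightarrow> \<exists>a\<in>A. \<exists>b\<in>B. e = {a, b}"
    using bip by (auto simp: bipartite_graph_def)
  define s where "s v = (if v \<in> A then 1 else - 1 :: real)" for v
  have ss: "s u * s v = - 1" if "adj G u v" for u v
    using AB(1) AB(2)[of "{u, v}"] that by (auto simp: adj_def s_def doubleton_eq_iff)
  have ss1: "s v * s v = 1" for v by (simp add: s_def)
  define n where "n = length vs"
  let ?S = "mat_diag n (\<lambda>i. s (vs ! i))"
  have c: "vmat vs h \<in> carrier_mat n n" for h by (simp add: n_def)
  have "?S * ?S = 1\<^sub>m n" by (simp add: mat_diag_diag ss1)
  moreover have "vmat vs (lap G) = ?S * vmat vs (slap G) * ?S"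
  proof (rule eq_matI)
    fix i j assume "i < dim_row (?S * vmat vs (slap G) * ?S)" "j < dim_col (?S * vmat vs (slap G) * ?S)"
    then have ij: "i < n" "j < n" by (simp_all add: mat_diag_def)
    have "?S * vmat vs (slap G) \<in> carrier_mat n n" by (rule mult_carrier_mat[OF mat_diag_dim c])
    from mat_diag_mult_right[OF this]
    have "(?S * vmat vs (slap G) * ?S) $$ (i, j) = s (vs ! i) * slap G (vs ! i) (vs ! j) * s (vs ! j)"
      unfolding mat_diag_mult_left[OF c] using ij by (simp add: vmat_def n_def mult.commute)
    also have "\<dots> = lap G (vs ! i) (vs ! j)"
      using ss[of "vs ! i" "vs ! j"] ss1[of "vs ! i"] simple_adjD(3)[OF G, of "vs ! i" "vs ! j"]
      by (auto simp: slap_def lap_def algebra_simps)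
    finally show "vmat vs (lap G) $$ (i, j) = (?S * vmat vs (slap G) * ?S) $$ (i, j)"
      using ij by (simp add: vmat_def n_def)
  qed (simp_all add: vmat_def n_def mat_diag_def)
  ultimately have "similar_mat_wit (vmat vs (lap G)) (vmat vs (slap G)) ?S ?S"
    using c[of "lap G"] c[of "slap G"] by (intro similar_mat_witI[of _ _ n]) (simp_all only: mat_diag_dim)
  then show ?thesis by (intro char_poly_similar) (auto simp: similar_mat_def)
qed

section \<open>Quadratic form of the signless Laplacian\<close>

definition vvec :: "'a list \<Rightarrow> ('a \<Rightarrow> real) \<Rightarrow> real vec" where
  "vvec vs y = vec (length vs) (\<lambda>i. y (vs ! i))"

lemma vvec_carrier [simp]: "vvec vs y \<in> carrier_vec (length vs)"
  by (simp add: vvec_def)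

lemma sum_nth_eq_sum_set:
  fixes g :: "'a \<Rightarrow> real"
  assumes "distinct vs"
  shows "(\<Sum>i<length vs. g (vs ! i)) = (\<Sum>v\<in>set vs. g v)"
  using sum.reindex_bij_betw[OF bij_betw_nth[OF assms refl refl]] by simp

lemma vmat_mult_vvec:
  assumes "distinct vs"
  shows "vmat vs h *\<^sub>v vvec vs y = vvec vs (\<lambda>u. \<Sum>v\<in>set vs. h u v * y v)"
  using sum_nth_eq_sum_set[OF assms]
  by (intro eq_vecI) (auto simp: vmat_def vvec_def scalar_prod_def lessThan_atLeast0)

lemma vvec_scalar_prod:
  assumes "distinct vs"
  shows "vvec vs x \<bullet> vvec vs y = (\<Sum>v\<in>set vs. x v * y v)"
  using sum_nth_eq_sum_set[OF assms, of "\<lambda>v. x v * y v"]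
  by (simp add: vvec_def scalar_prod_def lessThan_atLeast0)

lemma vvec_eq_iff: "vvec vs x = vvec vs y \<longleftrightarrow> (\<forall>v\<in>set vs. x v = y v)"
  by (auto simp: vvec_def vec_eq_iff all_set_conv_all_nth)

lemma vec_eq_vvec:
  assumes "distinct vs" "x \<in> carrier_vec (length vs)"
  obtains y where "x = vvec vs y"
proof -
  have "x = vvec vs (\<lambda>v. x $ the_inv_into {..<length vs} ((!) vs) v)"
    using assms by (intro eq_vecI)
      (auto simp: vvec_def inj_on_nth the_inv_into_f_f[where A = "{..<length vs}"])
  then show thesis by (rule that)
qed

lemma slap_apply:
  assumes G: "simple_graph G" and u: "u \<in> verts G"
  shows "(\<Sum>v\<in>verts G. slap G u v * y v) = (\<Sum>v | v \<in> verts G \<and> adj G u v. y u + y v)"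
proof -
  have fin: "finite (verts G)" using G by (simp add: simple_graph_def)
  have "(\<Sum>v\<in>verts G. slap G u v * y v) =
     (\<Sum>v\<in>verts G. (if v = u then real (vdegree G u) * y u else 0) + (if adj G u v then y v else 0))"
    by (intro sum.cong) (auto simp: slap_def algebra_simps)
  also have "\<dots> = real (vdegree G u) * y u + (\<Sum>v | v \<in> verts G \<and> adj G u v. y v)"
    using fin u by (simp add: sum.distrib sum.inter_filter)
  also have "\<dots> = (\<Sum>v | v \<in> verts G \<and> adj G u v. y u + y v)"
    by (simp add: sum.distrib vdegree_def)
  finally show ?thesis .
qed

text \<open>The double sum runs over ordered pairs and so counts every edge twice, whence the factor
  2; exchanging \<open>u\<close> and \<open>v\<close> symmetrises \<open>y u * (y u + y v)\<close>
  into the square.\<close>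

lemma slap_quadratic_form:
  assumes G: "simple_graph G"
  shows "2 * (\<Sum>u\<in>verts G. y u * (\<Sum>v\<in>verts G. slap G u v * y v)) =
    (\<Sum>u\<in>verts G. \<Sum>v\<in>verts G. if adj G u v then (y u + y v)\<^sup>2 else 0)"
proof -
  have fin: "finite (verts G)" using G by (simp add: simple_graph_def)
  let ?S = "\<Sum>u\<in>verts G. \<Sum>v\<in>verts G. if adj G u v then y u * (y u + y v) else 0"
  have 1: "(\<Sum>u\<in>verts G. y u * (\<Sum>v\<in>verts G. slap G u v * y v)) = ?S"
    using fin by (intro sum.cong)
      (auto simp: slap_apply[OF G] sum_distrib_left sum.inter_filter intro!: sum.cong)
  have "?S = (\<Sum>v\<in>verts G. \<Sum>u\<in>verts G. if adj G u v then y u * (y u + y v) else 0)"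
    by (rule sum.swap)
  also have "\<dots> = (\<Sum>u\<in>verts G. \<Sum>v\<in>verts G. if adj G u v then y v * (y u + y v) else 0)"
    by (intro sum.cong) (auto simp: adj_sym add.commute)
  finally have "2 * ?S = ?S + (\<Sum>u\<in>verts G. \<Sum>v\<in>verts G. if adj G u v then y v * (y u + y v) else 0)"
    by simp
  also have "\<dots> = (\<Sum>u\<in>verts G. \<Sum>v\<in>verts G. if adj G u v then (y u + y v)\<^sup>2 else 0)"
    unfolding sum.distrib[symmetric]
    by (intro sum.cong) (auto simp: power2_eq_square algebra_simps)
  finally show ?thesis using 1 by simp
qed

text \<open>The quadratic form is a sum of squares, which gives nonnegativity. For the eigenvalue 0
  every \<open>y u + y v\<close> along an edge vanishes; by connectedness \<open>y\<close> is then
  nowhere zero, and its sign is a proper two-colouring.\<close>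

lemma slap_eigenvalue_nonneg:
  assumes G: "simple_graph G" and vs: "distinct vs" "set vs = verts G"
    and ev: "eigenvalue (vmat vs (slap G)) e"
  shows "e \<ge> 0" and "e = 0 \<Longrightarrow> connected_graph G \<Longrightarrow> bipartite_graph G"
proof -
  have fin: "finite (verts G)" using G by (simp add: simple_graph_def)
  obtain x where x: "x \<in> carrier_vec (length vs)" "x \<noteq> 0\<^sub>v (length vs)"
    "vmat vs (slap G) *\<^sub>v x = e \<cdot>\<^sub>v x"
    using ev by (auto simp: eigenvalue_def eigenvector_def vmat_def)
  obtain y where y: "x = vvec vs y" using vec_eq_vvec[OF vs(1) x(1)] .
  have "e \<cdot>\<^sub>v x = vvec vs (\<lambda>u. e * y u)" unfolding y by (rule eq_vecI) (auto simp: vvec_def)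
  then have "vvec vs (\<lambda>u. \<Sum>v\<in>verts G. slap G u v * y v) = vvec vs (\<lambda>u. e * y u)"
    using x(3) unfolding y vmat_mult_vvec[OF vs(1)] vs(2) by simp
  then have ey: "(\<Sum>v\<in>verts G. slap G u v * y v) = e * y u" if "u \<in> verts G" for u
    using that unfolding vvec_eq_iff vs(2) by blast
  have "0\<^sub>v (length vs) = vvec vs (\<lambda>_. 0)" by (auto simp: vvec_def)
  then obtain w where w: "w \<in> verts G" "y w \<noteq> 0" using x(2) unfolding y by (auto simp: vvec_eq_iff vs)
  have form: "2 * (e * (\<Sum>u\<in>verts G. y u * y u)) =
    (\<Sum>u\<in>verts G. \<Sum>v\<in>verts G. if adj G u v then (y u + y v)\<^sup>2 else 0)"
  proof -
    have "(\<Sum>u\<in>verts G. y u * (\<Sum>v\<in>verts G. slap G u v * y v)) = e * (\<Sum>u\<in>verts G. y u * y u)"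
      unfolding sum_distrib_left[of e] by (intro sum.cong) (simp_all add: ey)
    then show ?thesis using slap_quadratic_form[OF G, of y] by simp
  qed
  have pos: "(\<Sum>u\<in>verts G. y u * y u) > 0"
    using fin w by (intro sum_pos2[where i = w]) (auto simp: zero_less_mult_iff)
  have "(\<Sum>u\<in>verts G. \<Sum>v\<in>verts G. if adj G u v then (y u + y v)\<^sup>2 else 0) \<ge> 0"
    by (intro sum_nonneg) auto
  then show "e \<ge> 0" using pos form by (metis mult.commute mult_less_0_iff not_less zero_less_numeral)
  assume e: "e = 0" and conn: "connected_graph G"
  have zero: "y u + y v = 0" if "adj G u v" for u v
  proof -
    have uv: "u \<in> verts G" "v \<in> verts G" using simple_adjD[OF G that] by auto
    have "(\<Sum>u\<in>verts G. \<Sum>v\<in>verts G. if adj G u v then (y u + y v)\<^sup>2 else 0) = 0"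
      using form e by simp
    then have "(\<Sum>v\<in>verts G. if adj G u v then (y u + y v)\<^sup>2 else 0) = 0"
      using uv fin by (subst (asm) sum_nonneg_eq_0_iff) (auto intro!: sum_nonneg)
    then have "(if adj G u v then (y u + y v)\<^sup>2 else 0) = 0"
      using uv fin by (subst (asm) sum_nonneg_eq_0_iff) auto
    then show ?thesis using that by simp
  qed
  have "(adj G)\<^sup>*\<^sup>* w v \<Longrightarrow> y v \<noteq> 0" for v
    by (induction rule: rtranclp_induct) (use w zero in force)+
  then have nz: "y v \<noteq> 0" if "v \<in> verts G" for v
    using conn w that by (auto simp: connected_graph_def)
  show "bipartite_graph G" unfolding bipartite_graph_def
  proof (intro exI conjI ballI)
    show "{v \<in> verts G. y v > 0} \<union> {v \<in> verts G. y v < 0} = verts G" using nz by force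
    fix d assume d: "d \<in> edges G"
    then obtain u v where uv: "d = {u, v}" using G by (auto simp: simple_graph_def)
    then have a: "adj G u v" using d by (simp add: adj_def)
    note V = simple_adjD[OF G a]
    show "\<exists>a\<in>{v \<in> verts G. y v > 0}. \<exists>b\<in>{v \<in> verts G. y v < 0}. d = {a, b}"
    proof (cases "y u > 0")
      case True
      then show ?thesis using zero[OF a] V uv by (intro bexI[of _ u] bexI[of _ v]) auto
    next
      case False
      then show ?thesis using zero[OF a] V nz[of u] uv
        by (intro bexI[of _ v] bexI[of _ u]) auto
    qed
  qed auto
qed

text \<open>The rows of the Laplacian sum to 0, so the all-ones vector lies in the kernel.\<close>

lemma det_lap_eq_0:
  assumes G: "simple_graph G" and vs: "distinct vs" "set vs = verts G" "vs \<noteq> []"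
  shows "det (vmat vs (lap G)) = 0"
proof -
  have fin: "finite (verts G)" using G by (simp add: simple_graph_def)
  have "(\<Sum>v\<in>verts G. lap G u v * 1) = 0" if "u \<in> verts G" for u
    using fin that by (simp add: lap_def sum_subtractf sum.inter_filter[symmetric] vdegree_def)
  then have "vmat vs (lap G) *\<^sub>v vvec vs (\<lambda>_. 1) = 0\<^sub>v (length vs)"
    unfolding vmat_mult_vvec[OF vs(1)] vs(2) using vs(2) nth_mem[of _ vs]
    by (intro eq_vecI) (auto simp: vvec_def)
  moreover have "vvec vs (\<lambda>_. 1) \<noteq> 0\<^sub>v (length vs)"
    using vs(3) by (auto simp: vvec_def vec_eq_iff)
  ultimately show ?thesis
    using det_0_iff_vec_prod_zero[OF vmat_carrier] vvec_carrier by blast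
qed

text \<open>Linear coefficients in the factorisation \<open>char_poly_lap_prod_K2\<close> are
  compared. The Laplacian factor has constant coefficient 0, so only its linear coefficient times
  the constant coefficient of the signless factor remains. The factor 2 appears because the double
  cover has twice as many vertices.\<close>

lemma two_num_spanning_trees_prod_K2:
  assumes G: "simple_graph G" and vs: "distinct vs" "set vs = verts G" "vs \<noteq> []"
  shows "2 * real (num_spanning_trees (graph_prod G K2)) =
    real (num_spanning_trees G) * det (vmat vs (slap G))"
proof -
  let ?G2 = "graph_prod G K2" and ?n = "length vs"
  note G2 = simple_graph_prod_K2[OF G]
  have n: "?n > 0" "card (verts G) = ?n" using vs distinct_card by fastforce+
  have n2: "length (vertex_list ?G2) = 2 * ?n"
    unfolding vertex_list(3)[OF G2] using n by (simp add: graph_prod_def K2_def card_cartesian_product)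
  have "(-1) ^ (2 * ?n - 1) * (real (2 * ?n) * real (num_spanning_trees ?G2)) =
      coeff (char_poly (vmat vs (lap G)) * char_poly (vmat vs (slap G))) 1"
    using coeff_char_poly_lap_1[OF G2 vertex_list(1,2)[OF G2]]
    unfolding n2 laplacian_mat_eq_vmat(1)[OF G2, symmetric] char_poly_lap_prod_K2[OF G vs(1,2)] by simp
  also have "\<dots> = coeff (char_poly (vmat vs (lap G))) 1 * coeff (char_poly (vmat vs (slap G))) 0"
    using coeff_char_poly_0[OF vmat_carrier, of vs "lap G"] det_lap_eq_0[OF G vs]
    by (simp add: coeff_mult)
  also have "\<dots> = (-1) ^ (2 * ?n - 1) * (real ?n * real (num_spanning_trees G) * det (vmat vs (slap G)))"
  proof -
    have "(-1 :: real) ^ (2 * ?n - 1) = (-1) ^ (?n - 1) * (-1) ^ ?n"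
      using n by (simp flip: power_add add: mult_2)
    then show ?thesis
      unfolding coeff_char_poly_lap_1[OF G vs(1,2)] coeff_char_poly_0[OF vmat_carrier] by simp
  qed
  finally show ?thesis using n by simp
qed

section \<open>The largest signless Laplacian eigenvalue\<close>

lemma adj_edgeI: "adj G u v \<Longrightarrow> {u, v} \<in> edges G" by (simp add: adj_def)

lemma vdegree_le_max:
  assumes "simple_graph G" "v \<in> verts G"
  shows "vdegree G v \<le> max_degree G" "min_degree G \<le> vdegree G v"
  using assms by (auto simp: max_degree_def min_degree_def simple_graph_def)

lemma max_degree_attained:
  assumes "simple_graph G" "verts G \<noteq> {}"
  obtains v where "v \<in> verts G" "vdegree G v = max_degree G"
proof -
  have "max_degree G \<in> vdegree G ` verts G"
    unfolding max_degree_def using assms by (intro Max_in) (auto simp: simple_graph_def)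
  then show thesis using that by auto
qed

lemma vdegree_less_card:
  assumes G: "simple_graph G" and v: "v \<in> verts G"
  shows "vdegree G v \<le> card (verts G) - 1"
    and "vdegree G v = card (verts G) - 1 \<Longrightarrow> u \<in> verts G \<Longrightarrow> u \<noteq> v \<Longrightarrow> adj G v u"
proof -
  have fin: "finite (verts G)" using G by (simp add: simple_graph_def)
  have sub: "{u \<in> verts G. adj G v u} \<subseteq> verts G - {v}" using simple_adjD[OF G] by blast
  have c: "card (verts G - {v}) = card (verts G) - 1" using fin v by simp
  show "vdegree G v \<le> card (verts G) - 1"
    unfolding vdegree_def c[symmetric] using fin sub by (intro card_mono) auto
  assume "vdegree G v = card (verts G) - 1" and u: "u \<in> verts G" "u \<noteq> v"
  then have "{u \<in> verts G. adj G v u} = verts G - {v}"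
    unfolding vdegree_def c[symmetric] using fin sub by (intro card_subset_eq) auto
  then show "adj G v u" using u by blast
qed

lemma min_degree_pos:
  assumes G: "simple_graph G" and conn: "connected_graph G" and n: "card (verts G) \<ge> 2"
  shows "min_degree G \<ge> 1"
proof -
  have fin: "finite (verts G)" using G by (simp add: simple_graph_def)
  have ne: "verts G \<noteq> {}" using n by auto
  have "min_degree G \<in> vdegree G ` verts G"
    unfolding min_degree_def using fin ne by (intro Min_in) auto
  then obtain v where v: "v \<in> verts G" "min_degree G = vdegree G v" by auto
  have "verts G \<noteq> {v}" using n by auto
  then obtain w where w: "w \<in> verts G" "w \<noteq> v" using v by auto
  then have "(adj G)\<^sup>*\<^sup>* v w" using conn v by (auto simp: connected_graph_def)
  then obtain u where "adj G v u" using w by (auto elim: converse_rtranclpE)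
  then have "u \<in> {u \<in> verts G. adj G v u}" using simple_adjD[OF G] by blast
  then have "card {u \<in> verts G. adj G v u} > 0" using fin card_gt_0_iff by fastforce
  then show ?thesis using v by (simp add: vdegree_def)
qed

text \<open>Otherwise any three vertices would form a triangle, but two of them lie in the same
  class.\<close>

lemma bipartite_no_complete:
  assumes G: "simple_graph G" and bip: "bipartite_graph G" and n: "card (verts G) \<ge> 3"
  shows "\<exists>v\<in>verts G. vdegree G v < card (verts G) - 1"
proof (rule ccontr)
  assume "\<not> ?thesis"
  then have "vdegree G v = card (verts G) - 1" if "v \<in> verts G" for v
    using vdegree_less_card(1)[OF G that] that by fastforce
  then have adj: "adj G u v" if "u \<in> verts G" "v \<in> verts G" "u \<noteq> v" for u v
    using vdegree_less_card(2)[OF G] that by metis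
  obtain A B where AB: "A \<union> B = verts G" "A \<inter> B = {}"
    "\<And>e. e \<in> edges G \<Longrightarrow> \<exists>a\<in>A. \<exists>b\<in>B. e = {a, b}"
    using bip by (auto simp: bipartite_graph_def)
  have part: "\<not> (u \<in> A \<and> v \<in> A) \<and> \<not> (u \<in> B \<and> v \<in> B)" if "adj G u v" for u v
    using AB(2) AB(3)[OF adj_edgeI[OF that]] by (auto simp: doubleton_eq_iff)
  obtain S where "S \<subseteq> verts G" "card S = 3" using n by (metis obtain_subset_with_card_n)
  then obtain a b c where "a \<in> verts G" "b \<in> verts G" "c \<in> verts G" "a \<noteq> b" "b \<noteq> c" "a \<noteq> c"
    by (auto simp: card_3_iff)
  then show False using part[of a b] part[of b c] part[of a c] adj AB(1) by blast
qed

text \<open>The degree sum is the sum of the eigenvalues, and the strict bound keeps the mean of the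
  \<open>n - 1\<close> nonzero eigenvalues of a connected bipartite graph below
  \<open>max_degree G + 1\<close>. It follows from the first bound if the maximum degree is below
  \<open>n - 1\<close>, and otherwise from a vertex of smaller degree.\<close>

lemma sum_vdegree_bounds:
  assumes G: "simple_graph G" and ne: "verts G \<noteq> {}"
  shows "(\<Sum>v\<in>verts G. vdegree G v) \<le> card (verts G) * max_degree G"
    and "bipartite_graph G \<Longrightarrow> card (verts G) \<ge> 3 \<Longrightarrow>
      (\<Sum>v\<in>verts G. vdegree G v) < (card (verts G) - 1) * (max_degree G + 1)"
proof -
  let ?n = "card (verts G)" and ?\<Delta> = "max_degree G"
  have fin: "finite (verts G)" using G by (simp add: simple_graph_def)
  show le: "(\<Sum>v\<in>verts G. vdegree G v) \<le> ?n * ?\<Delta>"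
    using sum_bounded_above[of "verts G" "vdegree G" ?\<Delta>] vdegree_le_max(1)[OF G] by simp
  assume bip: "bipartite_graph G" and n: "?n \<ge> 3"
  obtain m where m: "?n = Suc m" using n by (cases ?n) auto
  have "?\<Delta> \<le> m" using max_degree_attained[OF G ne] vdegree_less_card(1)[OF G] m
    by (metis diff_Suc_1)
  then consider "?\<Delta> < m" | "?\<Delta> = m" by linarith
  then show "(\<Sum>v\<in>verts G. vdegree G v) < (?n - 1) * (?\<Delta> + 1)"
  proof cases
    case 1
    then show ?thesis using le m by simp
  next
    case 2
    obtain w where w: "w \<in> verts G" "vdegree G w < m"
      using bipartite_no_complete[OF G bip n] m by auto
    have "(\<Sum>v\<in>verts G. vdegree G v) < (\<Sum>v\<in>verts G. m)"
      using w 2 vdegree_le_max(1)[OF G] fin by (intro sum_strict_mono_ex1) auto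
    then show ?thesis using 2 m by (simp add: mult.commute)
  qed
qed

text \<open>\<open>T\<close> is the largest root of \<open>(x - \<Delta>)(x - \<delta>) = \<Delta>\<close>, that is, the largest eigenvalue of the
  quotient matrix of a star with centre weight \<open>\<Delta>\<close> and leaf weights \<open>\<delta>\<close>.\<close>

lemma star_bound:
  fixes \<Delta> \<delta> T :: real
  assumes T: "T = 1 / 2 * (\<Delta> + \<delta> + sqrt ((\<Delta> - \<delta>)\<^sup>2 + 4 * \<Delta>))" and d: "1 \<le> \<delta>" "\<delta> \<le> \<Delta>"
  shows "(T - \<Delta>) * (T - \<delta>) = \<Delta>" and "T \<ge> \<Delta> + 1"
proof -
  define s where "s = sqrt ((\<Delta> - \<delta>)\<^sup>2 + 4 * \<Delta>)"
  have s2: "s * s = (\<Delta> - \<delta>)\<^sup>2 + 4 * \<Delta>"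
    using d by (simp add: s_def)
  have "2 * (T - \<Delta>) = s - (\<Delta> - \<delta>)" "2 * (T - \<delta>) = s + (\<Delta> - \<delta>)"
    unfolding T s_def[symmetric] by simp_all
  then have "(2 * (T - \<Delta>)) * (2 * (T - \<delta>)) = s * s - (\<Delta> - \<delta>)\<^sup>2"
    by (simp only:) (simp add: algebra_simps power2_eq_square)
  moreover have "(2 * (T - \<Delta>)) * (2 * (T - \<delta>)) = 4 * ((T - \<Delta>) * (T - \<delta>))"
    by (simp add: algebra_simps)
  ultimately show "(T - \<Delta>) * (T - \<delta>) = \<Delta>" using s2 by linarith
  \<comment> \<open>The two sides differ by \<open>4 * (\<delta> - 1)\<close>, which is
    nonnegative.\<close>
  have "(\<Delta> - \<delta> + 2)\<^sup>2 \<le> (\<Delta> - \<delta>)\<^sup>2 + 4 * \<Delta>"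
    using d by (simp add: power2_eq_square algebra_simps)
  then have "\<Delta> - \<delta> + 2 \<le> s" unfolding s_def by (rule real_le_rsqrt)
  then show "T \<ge> \<Delta> + 1" unfolding T s_def[symmetric] by simp
qed

text \<open>The test vector \<open>y\<close> satisfies \<open>Q y \<ge> T y\<close> wherever it is
  nonzero, with equality at the centre \<open>c\<close> by the equation for \<open>T\<close>, so its
  Rayleigh quotient is at least \<open>T\<close>. If \<open>T\<close> is the largest eigenvalue,
  then \<open>Q y = T y\<close>, which leaves no room for vertices at distance 2 from
  \<open>c\<close> or for edges between neighbours of \<open>c\<close>.\<close>

lemma largest_eigenvalue_lower_bound:
  fixes T :: real
  assumes G: "simple_graph G" and conn: "connected_graph G" and n: "card (verts G) \<ge> 2"
    and T: "(T - real (max_degree G)) * (T - real (min_degree G)) = real (max_degree G)"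
      "T \<ge> real (max_degree G) + 1"
  shows "T \<le> eigenvalues_desc (signless_laplacian_mat G) ! 0"
    and "eigenvalues_desc (signless_laplacian_mat G) ! 0 = T \<Longrightarrow> star_graph G"
proof -
  let ?vs = "vertex_list G" and ?\<Delta> = "real (max_degree G)" and ?\<delta> = "real (min_degree G)"
  let ?Q = "vmat ?vs (slap G)"
  define V where "V = verts G"
  have fin: "finite V" using G by (simp add: simple_graph_def V_def)
  have ne: "verts G \<noteq> {}" using n by auto
  note vl = vertex_list[OF G]
  note spec = symmetric_eigenvalues_desc[OF vmat_carrier transpose_vmat_slap[of ?vs G]]
  obtain c where c: "c \<in> V" "vdegree G c = max_degree G"
    using max_degree_attained[OF G ne] unfolding V_def by blast
  define N where "N u = {v \<in> V. adj G u v}" for u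
  have cardN: "card (N u) = vdegree G u" for u by (simp add: N_def vdegree_def V_def)
  have finN: "finite (N u)" for u using fin by (simp add: N_def)
  have "?\<delta> \<le> ?\<Delta>" using vdegree_le_max[OF G, of c] c by (simp add: V_def)
  then have T\<delta>: "T - ?\<delta> > 0" using T by simp
  define y where "y u = (if u = c then T - ?\<delta> else if adj G c u then 1 else 0)" for u
  have ynn: "y u \<ge> 0" for u using T\<delta> by (simp add: y_def)
  define z where "z u = (\<Sum>v\<in>V. slap G u v * y v)" for u
  have z: "z u = real (vdegree G u) * y u + (\<Sum>v\<in>N u. y v)" if "u \<in> V" for u
    using slap_apply[OF G, of u y] that
    by (simp add: z_def V_def sum.distrib N_def[unfolded V_def] flip: cardN)
  have ncc: "\<not> adj G c c" using simple_adjD(3)[OF G] by blast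
  have zc: "z c = T * y c"
  proof -
    have "(\<Sum>v\<in>N c. y v) = (\<Sum>v\<in>N c. 1)"
      using ncc by (intro sum.cong) (auto simp: N_def y_def)
    then have "z c = ?\<Delta> * (T - ?\<delta>) + ?\<Delta>"
      using z[OF c(1)] c(2) cardN[of c] by (simp add: y_def)
    then show ?thesis using T(1) by (simp add: y_def algebra_simps)
  qed
  \<comment> \<open>The degree of a neighbour of \<open>c\<close> contributes at least the minimum
    degree, and \<open>c\<close> itself contributes \<open>T\<close> minus the minimum
    degree.\<close>
  have zn: "z u \<ge> T * y u" if u: "adj G c u" for u
  proof -
    have uV: "u \<in> V" "c \<in> N u" "u \<noteq> c" using simple_adjD[OF G u] u c(1) by (auto simp: V_def N_def adj_sym)
    have "y c \<le> (\<Sum>v\<in>N u. y v)" using member_le_sum[OF uV(2), of y] ynn finN by simp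
    moreover have "?\<delta> \<le> real (vdegree G u)" using vdegree_le_max(2)[OF G] uV by (simp add: V_def)
    ultimately show ?thesis using z[OF uV(1)] uV u by (simp add: y_def)
  qed
  have zy: "z u * y u \<ge> T * y u * y u" if "u \<in> V" for u
    using zc zn[of u] ynn[of u] by (cases "u = c \<or> adj G c u") (auto simp: y_def intro: mult_right_mono)
  define x where "x = vvec ?vs y"
  have xx: "x \<bullet> x = (\<Sum>u\<in>V. y u * y u)" "x \<bullet> (?Q *\<^sub>v x) = (\<Sum>u\<in>V. z u * y u)"
    unfolding x_def vmat_mult_vvec[OF vl(1)] vvec_scalar_prod[OF vl(1)] vl(2) V_def z_def
    by (simp_all add: mult.commute)
  have ge: "T * (x \<bullet> x) \<le> x \<bullet> (?Q *\<^sub>v x)"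
    unfolding xx sum_distrib_left by (intro sum_mono) (use zy in \<open>simp add: mult.assoc\<close>)
  have pos: "x \<bullet> x > 0" unfolding xx
    using fin c T\<delta> by (intro sum_pos2[where i = c]) (auto simp: y_def)
  define q where "q = eigenvalues_desc ?Q ! 0"
  have q: "q = eigenvalues_desc (signless_laplacian_mat G) ! 0"
    by (simp add: q_def laplacian_mat_eq_vmat[OF G])
  have xc: "x \<in> carrier_vec (length ?vs)" by (simp add: x_def)
  have len: "length ?vs > 0" using vl n by simp
  show Tq: "T \<le> eigenvalues_desc (signless_laplacian_mat G) ! 0"
  proof (rule ccontr)
    assume "\<not> ?thesis"
    \<comment> \<open>If the largest eigenvalue \<open>q\<close> were below \<open>T\<close>, the
      Rayleigh lemma would apply to \<open>q\<close> as well and make \<open>x\<close> an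
      eigenvector for \<open>q\<close>; its quotient would be \<open>q\<close> instead of at least
      \<open>T\<close>.\<close>
    then have qT: "q < T" using q by simp
    then have "q * (x \<bullet> x) < T * (x \<bullet> x)" using pos by simp
    then have "?Q *\<^sub>v x = q \<cdot>\<^sub>v x" using spec(5)[OF xc len, where T = q] ge by (simp add: q_def)
    then have "x \<bullet> (?Q *\<^sub>v x) = q * (x \<bullet> x)" by (simp add: x_def)
    with ge \<open>q * (x \<bullet> x) < T * (x \<bullet> x)\<close> show False by simp
  qed
  assume "eigenvalues_desc (signless_laplacian_mat G) ! 0 = T"
  then have "?Q *\<^sub>v x = T \<cdot>\<^sub>v x" using spec(5)[OF xc len, where T = T] ge q by (simp add: q_def)
  moreover have "T \<cdot>\<^sub>v x = vvec ?vs (\<lambda>u. T * y u)" by (rule eq_vecI) (auto simp: x_def vvec_def)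
  ultimately have "vvec ?vs z = vvec ?vs (\<lambda>u. T * y u)"
    unfolding x_def vmat_mult_vvec[OF vl(1)] vl(2) z_def V_def by simp
  then have zT: "z u = T * y u" if "u \<in> V" for u
    using that unfolding vvec_eq_iff vl(2) V_def by blast
  \<comment> \<open>A vertex \<open>w\<close> outside the closed neighbourhood of \<open>c\<close>
    has \<open>y w = 0\<close>, yet a neighbour inside it makes the entry of \<open>Q y\<close> at
    \<open>w\<close> positive.\<close>
  have closed: "w = c \<or> adj G c w" if uw: "adj G u w" and u: "u = c \<or> adj G c u" for u w
  proof (rule ccontr)
    assume w: "\<not> (w = c \<or> adj G c w)"
    have wV: "w \<in> V" "u \<in> N w" using simple_adjD[OF G uw] uw by (auto simp: V_def N_def adj_sym)
    have "y u \<le> (\<Sum>v\<in>N w. y v)" using member_le_sum[OF wV(2), of y] ynn finN by simp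
    moreover have "y u > 0" using u T\<delta> by (auto simp: y_def)
    ultimately show False using zT[OF wV(1)] z[OF wV(1)] w by (simp add: y_def)
  qed
  have "(adj G)\<^sup>*\<^sup>* c u \<Longrightarrow> u = c \<or> adj G c u" for u
    by (induction rule: rtranclp_induct) (use closed in blast)+
  then have all: "adj G c u" if "u \<in> V - {c}" for u
    using conn c(1) that unfolding connected_graph_def V_def by blast
  \<comment> \<open>A neighbour of \<open>u\<close> other than \<open>c\<close> would add 1 to the
    sum at \<open>u\<close> and push the entry of \<open>Q y\<close> above \<open>T\<close>.\<close>
  have leaf: "w = c" if u: "u \<in> V - {c}" and uw: "adj G u w" for u w
  proof (rule ccontr)
    assume "w \<noteq> c"
    have uV: "u \<in> V" "c \<in> N u" "w \<in> N u" "u \<noteq> c"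
      using simple_adjD[OF G uw] u uw all[OF u] c(1) by (auto simp: V_def N_def adj_sym)
    have wc: "y w = 1" using all[of w] uV(3) \<open>w \<noteq> c\<close> by (auto simp: y_def N_def)
    have "(\<Sum>v\<in>{c, w}. y v) \<le> (\<Sum>v\<in>N u. y v)"
      using uV finN ynn by (intro sum_mono2) auto
    then have "T - ?\<delta> + 1 \<le> (\<Sum>v\<in>N u. y v)" using \<open>w \<noteq> c\<close> wc by (simp add: y_def)
    moreover have "?\<delta> \<le> real (vdegree G u)" using vdegree_le_max(2)[OF G] uV by (simp add: V_def)
    ultimately show False using zT[OF uV(1)] z[OF uV(1)] all[OF u] uV by (simp add: y_def)
  qed
  have "edges G = {{c, v} |v. v \<in> verts G - {c}}"
  proof (intro equalityI subsetI)
    fix e assume e: "e \<in> edges G"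
    then obtain a b where ab: "e = {a, b}" using G by (auto simp: simple_graph_def)
    then have adj: "adj G a b" using e by (simp add: adj_def)
    note D = simple_adjD[OF G adj]
    show "e \<in> {{c, v} |v. v \<in> verts G - {c}}"
    proof (cases "a = c")
      case False
      then have "b = c" using leaf[of a b] D adj by (auto simp: V_def)
      then show ?thesis using ab D False by (auto simp: insert_commute)
    qed (use ab D in auto)
  next
    fix e assume "e \<in> {{c, v} |v. v \<in> verts G - {c}}"
    then show "e \<in> edges G" using all by (auto simp: V_def adj_def)
  qed
  then show "star_graph G" using c(1) by (auto simp: star_graph_def V_def)
qed

section \<open>Power sums of the Laplacian spectra\<close>

lemma coeff_prod_linear_0: "coeff (\<Prod>i<n. [:- x i, 1:]) 0 = (-1) ^ n * (\<Prod>i<n. x i)"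
  for x :: "nat \<Rightarrow> real"
  by (induction n) (simp_all add: coeff_mult)

text \<open>Strictness in the bipartite part excludes stars with \<open>k = 0\<close>: there
  \<open>T = n\<close> is the largest eigenvalue, \<open>t = 1\<close>, the other nonzero
  eigenvalues are 1, and both sides equal \<open>n powr \<alpha> + (n - 2)\<close>.\<close>

theorem theorem3p4:
  fixes G :: "'a ugraph" and \<alpha> k :: real
    and n t :: nat and \<Delta>\<^sub>1 \<delta> t\<^sub>1 T :: real
  assumes "simple_graph G" and "connected_graph G"
    and "n = card (verts G)" and "n \<ge> 3"
    and "t = num_spanning_trees G"
    and "\<Delta>\<^sub>1 = real (max_degree G)" and "\<delta> = real (min_degree G)"
    and "t\<^sub>1 = 2 * real (num_spanning_trees (graph_prod G K2)) / real (num_spanning_trees G)"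
    and "T = 1 / 2 * (\<Delta>\<^sub>1 + \<delta> + sqrt ((\<Delta>\<^sub>1 - \<delta>)\<^sup>2 + 4 * \<Delta>\<^sub>1))"
    and "\<alpha> \<noteq> 0" and "\<alpha> \<noteq> 1" and "k \<ge> 0"
  shows "(bipartite_graph G \<longrightarrow>
           (let R = (real n - 2) * (real n * real t) powr (\<alpha> / (real n - 1)) *
                      ((k + 1) * (real n * real t) powr (\<alpha> / ((k + 1) * (real n - 1) * (real n - 2)))
                         / T powr (\<alpha> / ((k + 1) * (real n - 2))) - k)
                    + T powr \<alpha>
            in s_power_sum \<alpha> G = sigma_power_sum \<alpha> G \<and>
               s_power_sum \<alpha> G \<ge> R \<and>
               (\<not> (k = 0 \<and> star_graph G) \<longrightarrow> s_power_sum \<alpha> G > R)))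
       \<and> (\<not> bipartite_graph G \<longrightarrow>
           s_power_sum \<alpha> G >
             (real n - 1) * t\<^sub>1 powr (\<alpha> / real n) *
               ((k + 1) * t\<^sub>1 powr (\<alpha> / ((k + 1) * real n * (real n - 1)))
                  / T powr (\<alpha> / ((k + 1) * (real n - 1))) - k)
             + T powr \<alpha>)"
proof -
  note G = assms(1) and conn = assms(2) and n = assms(3,4)
  let ?vs = "vertex_list G"
  let ?Q = "vmat ?vs (slap G)"
  define x where "x i = eigenvalues_desc (signless_laplacian_mat G) ! i" for i
  note vl = vertex_list[OF G]
  have len: "length ?vs = n" using vl n by simp
  have ne: "verts G \<noteq> {}" "?vs \<noteq> []" using n len by auto
  have Q: "signless_laplacian_mat G = ?Q" by (rule laplacian_mat_eq_vmat(2)[OF G])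
  have Qc: "?Q \<in> carrier_mat n n" using len vmat_carrier by metis
  note spec = symmetric_eigenvalues_desc(2-4)[OF Qc transpose_vmat_slap[of ?vs G], folded Q, folded x_def, unfolded Q]
  have ev: "eigenvalue ?Q (x i)" if "i < n" for i
    unfolding eigenvalue_root_char_poly[OF Qc] spec(2) poly_prod using that by (auto intro!: prod_zero)
  have nonneg: "x i \<ge> 0" if "i < n" for i
    using slap_eigenvalue_nonneg(1)[OF G vl(1,2) ev[OF that]] .
  have sumdeg: "(\<Sum>i<n. x i) = real (\<Sum>v\<in>verts G. vdegree G v)"
  proof -
    have "(\<Sum>i<n. x i) = (\<Sum>i<length ?vs. real (vdegree G (?vs ! i)))"
      unfolding spec(3) using len simple_adjD(3)[OF G]
      by (intro sum.cong) (auto simp: vmat_def slap_def)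
    then show ?thesis using sum_nth_eq_sum_set[OF vl(1), of "\<lambda>v. real (vdegree G v)"] vl(2) by simp
  qed
  have \<delta>: "1 \<le> \<delta>" using min_degree_pos[OF G conn] n assms(7) by simp
  have "\<delta> \<le> \<Delta>\<^sub>1" using ne(1) vdegree_le_max[OF G] assms(6,7) by fastforce
  note Tb = star_bound[OF assms(9) \<delta> this]
  have Tpos: "T > 0" using Tb(2) assms(6) by simp
  have x0: "T \<le> x 0" "x 0 = T \<Longrightarrow> star_graph G"
    using largest_eigenvalue_lower_bound[OF G conn, of T] Tb n assms(6,7) by (simp_all add: x_def)
  have s: "s_power_sum \<alpha> G = (\<Sum>i<n. x i powr \<alpha>)" by (simp add: s_power_sum_def x_def n)
  have det: "det ?Q = (\<Prod>i<n. x i)"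
    using coeff_char_poly_0[OF Qc] unfolding spec(2) coeff_prod_linear_0 by simp
  show ?thesis
  proof (intro conjI impI)
    assume bip: "bipartite_graph G"
    define N where "N = n - 1"
    have N: "n = Suc N" "N \<ge> 2" using n by (auto simp: N_def)
    note cp = char_poly_lap_eq_slap_if_bipartite[OF G bip vl(1)]
    \<comment> \<open>The signless Laplacian shares its characteristic polynomial with the singular
      Laplacian, so 0 is an eigenvalue; in a nonincreasing list of nonnegative numbers it must be
      the last entry \<open>x N\<close>.\<close>
    have "(\<Prod>i<n. x i) = 0"
      using det coeff_char_poly_0[OF Qc] coeff_char_poly_0[OF vmat_carrier, of ?vs "lap G"]
        det_lap_eq_0[OF G vl(1,2) ne(2)] cp by simp
    then obtain i where i: "i < n" "x i = 0" by (auto simp: prod_zero_iff)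
    then have xN: "x N = 0" using spec(1)[of i N] nonneg[of N] N by simp
    have "(-1) ^ N * (real n * real t) = coeff (\<Prod>i<n. [:- x i, 1:]) 1"
      using coeff_char_poly_lap_1[OF G vl(1,2)] cp spec(2) len N assms(5) by simp
    \<comment> \<open>The factor of \<open>x N = 0\<close> is the polynomial variable itself, which
      shifts the coefficient index by one.\<close>
    also have "\<dots> = coeff (\<Prod>i<N. [:- x i, 1:]) 0"
      by (simp add: N xN coeff_pCons_Suc)
    also have "\<dots> = (-1) ^ N * (\<Prod>i<N. x i)" by (rule coeff_prod_linear_0)
    finally have p: "real n * real t = (\<Prod>i<N. x i)" by simp
    have "real n * real t > 0" using num_spanning_trees_pos[OF G conn] n assms(5) by simp
    then have "x i \<noteq> 0" if "i < N" for i
      using that unfolding p by (metis finite_lessThan lessThan_iff less_irrefl prod_zero)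
    then have pos: "x i > 0" if "i < N" for i using nonneg[of i] that N by fastforce
    have "(\<Sum>i<N. x i) = real (\<Sum>v\<in>verts G. vdegree G v)" using sumdeg N xN by simp
    also have "\<dots> < real ((card (verts G) - 1) * (max_degree G + 1))"
      using sum_vdegree_bounds(2)[OF G ne(1) bip] n unfolding of_nat_less_iff by simp
    also have "\<dots> = real N * (\<Delta>\<^sub>1 + 1)"
      by (simp only: N_def n(1) assms(6) of_nat_mult of_nat_add of_nat_1)
    also have "\<dots> \<le> real N * T" using Tb(2) by (intro mult_left_mono) auto
    finally have sum: "(\<Sum>i<N. x i) < real N * T" .
    \<comment> \<open>The term of \<open>x N\<close> is \<open>0 powr \<alpha> = 0\<close>, whatever
      the sign of the exponent.\<close>
    have sN: "s_power_sum \<alpha> G = (\<Sum>i<N. x i powr \<alpha>)" unfolding s N by (simp add: xN)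
    have "laplacian_mat G = vmat ?vs (lap G)" by (rule laplacian_mat_eq_vmat(1)[OF G])
    then have "eigenvalues_desc (laplacian_mat G) = eigenvalues_desc (signless_laplacian_mat G)"
      using cp Q by (simp add: eigenvalues_desc_def)
    then have sigma: "sigma_power_sum \<alpha> G = (\<Sum>i<N. x i powr \<alpha>)"
      by (simp add: sigma_power_sum_def x_def N_def n)
    have nN: "real N = real n - 1" "real N - 1 = real n - 2" using N by auto
    note bound = power_sum_lower_bound[OF N(2) pos p Tpos x0(1) sum \<open>\<alpha> \<noteq> 0\<close> \<open>k \<ge> 0\<close>,
        folded sN, unfolded nN]
    show "let R = (real n - 2) * (real n * real t) powr (\<alpha> / (real n - 1)) *
                      ((k + 1) * (real n * real t) powr (\<alpha> / ((k + 1) * (real n - 1) * (real n - 2)))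
                         / T powr (\<alpha> / ((k + 1) * (real n - 2))) - k)
                    + T powr \<alpha>
            in s_power_sum \<alpha> G = sigma_power_sum \<alpha> G \<and>
               s_power_sum \<alpha> G \<ge> R \<and>
               (\<not> (k = 0 \<and> star_graph G) \<longrightarrow> s_power_sum \<alpha> G > R)"
      unfolding Let_def
    proof (intro conjI impI)
      show "s_power_sum \<alpha> G = sigma_power_sum \<alpha> G" using sN sigma by simp
    next
      assume "\<not> (k = 0 \<and> star_graph G)"
      \<comment> \<open>If \<open>k = 0\<close>, the graph is not a star, which rules out
        \<open>x 0 = T\<close>.\<close>
      then have "x 0 > T \<or> k > 0" using x0 \<open>k \<ge> 0\<close> by fastforce
      then show "s_power_sum \<alpha> G > (real n - 2) * (real n * real t) powr (\<alpha> / (real n - 1)) *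
                      ((k + 1) * (real n * real t) powr (\<alpha> / ((k + 1) * (real n - 1) * (real n - 2)))
                         / T powr (\<alpha> / ((k + 1) * (real n - 2))) - k)
                    + T powr \<alpha>"
        using bound(2) by simp
    qed (use bound(1) in simp)
  next
    assume nb: "\<not> bipartite_graph G"
    \<comment> \<open>In a connected graph the eigenvalue 0 would force a bipartition.\<close>
    then have pos: "x i > 0" if "i < n" for i
      using nonneg[OF that] slap_eigenvalue_nonneg(2)[OF G vl(1,2) ev[OF that]] conn by fastforce
    have "real t > 0" using num_spanning_trees_pos[OF G conn] assms(5) by simp
    then have p: "t\<^sub>1 = (\<Prod>i<n. x i)"
      unfolding assms(8) two_num_spanning_trees_prod_K2[OF G vl(1,2) ne(2)] det
      using assms(5) by simp
    have "(\<Sum>i<n. x i) \<le> real (card (verts G) * max_degree G)"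
      unfolding sumdeg of_nat_le_iff by (rule sum_vdegree_bounds(1)[OF G ne(1)])
    also have "\<dots> = real n * \<Delta>\<^sub>1" by (simp add: n assms(6))
    also have "\<dots> < real n * T" using Tb(2) n by simp
    finally have sum: "(\<Sum>i<n. x i) < real n * T" .
    \<comment> \<open>A star is bipartite with its centre as one class. So the largest eigenvalue
      exceeds \<open>T\<close>, and the bound is strict even for \<open>k = 0\<close>.\<close>
    have "\<not> star_graph G"
    proof
      assume "star_graph G"
      then obtain c where c: "c \<in> verts G" "edges G = {{c, v} | v. v \<in> verts G - {c}}"
        by (auto simp: star_graph_def)
      then have "bipartite_graph G" unfolding bipartite_graph_def
        by (intro exI[of _ "{c}"] exI[of _ "verts G - {c}"]) auto
      with nb show False by simp
    qed
    then have strict: "x 0 > T \<or> k > 0" using x0 by fastforce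
    show "s_power_sum \<alpha> G >
             (real n - 1) * t\<^sub>1 powr (\<alpha> / real n) *
               ((k + 1) * t\<^sub>1 powr (\<alpha> / ((k + 1) * real n * (real n - 1)))
                  / T powr (\<alpha> / ((k + 1) * (real n - 1))) - k)
             + T powr \<alpha>"
      unfolding s
      using power_sum_lower_bound(2)[OF _ pos p Tpos x0(1) sum \<open>\<alpha> \<noteq> 0\<close> \<open>k \<ge> 0\<close> strict] n by simp
  qed
qed

end
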